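(* For all integers $n\geq 3$ and $k\geq 1$, let $\beta\in B_{n+2}$ be the braid $$\beta=(\sigma_1\cdots\sigma_{n-1})^{nk+1}\,(\sigma_{n+1})^{4k+1}.$$ Then $\ell(\beta)=4k+1$ and $\#(SC(\beta))\geq 2^{n-2}(n-1)^{2k-1}$.
   Context: For $N\ge 2$, $B_N$ is the braid group on $N$ strands with standard generators $\sigma_1,\ldots,\sigma_{N-1}$, and $B_N^+$ is the submonoid generated by them, whose elements are called positive. Write $a\preccurlyeq b$ iff $a^{-1}b\in B_N^+$; this is a lattice order on $B_N$, with meet denoted $\wedge$. Let $\Delta=\sigma_1(\sigma_2\sigma_1)\cdots(\sigma_{N-1}\sigma_{N-2}\cdots\sigma_1)\in B_N$. Every $x\in B_N$ has a unique left normal form $x=\Delta^p x_1\cdots x_r$, where $p$ is the maximal integer such that $\Delta^{-p}x$ is positive, each $x_i$ is nontrivial, and $x_i=(x_i\cdots x_r)\wedge\Delta$ for $i=1,\ldots,r$. Put $\inf(x)=p$ and $\ell(x)=r$ (canonical length). The initial factor is $\iota(x)=(x\Delta^{-\inf(x)})\wedge\Delta$. The preferred prefix is $\mathfrak p(x)=\iota(x)\wedge\iota(x^{-1})$, and the cyclic sliding of $x$ is $\mathfrak s(x)=\mathfrak p(x)^{-1}x\,\mathfrak p(x)$. An element $y$ is in a sliding circuit if $\mathfrak s^m(y)=y$ for some $m>0$. The set of sliding circuits $SC(x)$ is the set of conjugates of $x$ (in $B_N$) that are in a sliding circuit. In the claim, all these notions are taken in $B_N$ with $N=n+2$. *)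

theory Defs
  imports "HOL-Algebra.Group" "HOL-Algebra.Lattice" "HOL-Library.Equipollence"
begin

text \<open>The braid group \<open>B\<^sub>N\<close> by Artin's presentation. The letter \<open>(i, True)\<close> stands for
  \<open>\<sigma>\<^sub>i\<close> and \<open>(i, False)\<close> for its inverse; generators are indexed from 1 to \<open>N - 1\<close>.\<close>

type_synonym braid_word = "(nat \<times> bool) list"

definition braid_words :: "nat \<Rightarrow> braid_word set" where
  "braid_words N = lists ({1..<N} \<times> UNIV)"

inductive braid_equiv :: "nat \<Rightarrow> braid_word \<Rightarrow> braid_word \<Rightarrow> bool" for N :: nat where
  refl: "w \<in> braid_words N \<Longrightarrow> braid_equiv N w w"
| sym: "braid_equiv N v w \<Longrightarrow> braid_equiv N w v"
| trans: "braid_equiv N u v \<Longrightarrow> braid_equiv N v w \<Longrightarrow> braid_equiv N u w"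
| cong: "braid_equiv N u u' \<Longrightarrow> braid_equiv N v v' \<Longrightarrow> braid_equiv N (u @ v) (u' @ v')"
| cancel: "i \<in> {1..<N} \<Longrightarrow> braid_equiv N [(i, b), (i, \<not> b)] []"
| far: "i \<in> {1..<N} \<Longrightarrow> j \<in> {1..<N} \<Longrightarrow> i + 2 \<le> j \<Longrightarrow>
    braid_equiv N [(i, True), (j, True)] [(j, True), (i, True)]"
| braid: "i \<in> {1..<N} \<Longrightarrow> i + 1 \<in> {1..<N} \<Longrightarrow>
    braid_equiv N [(i, True), (i + 1, True), (i, True)] [(i + 1, True), (i, True), (i + 1, True)]"

definition braid_class :: "nat \<Rightarrow> braid_word \<Rightarrow> braid_word set" where
  "braid_class N w = {v. braid_equiv N w v}"

type_synonym braid = "braid_word set"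

definition braid_group :: "nat \<Rightarrow> braid monoid" where
  "braid_group N =
    \<lparr>carrier = braid_class N ` braid_words N,
     mult = (\<lambda>x y. \<Union>u\<in>x. \<Union>v\<in>y. braid_class N (u @ v)),
     one = braid_class N []\<rparr>"

lemma braid_equiv_words:
  "braid_equiv N u v \<Longrightarrow> u \<in> braid_words N \<and> v \<in> braid_words N"
  by (induction rule: braid_equiv.induct) (auto simp: braid_words_def)

lemma braid_class_eq_iff:
  assumes "u \<in> braid_words N"
  shows "braid_class N u = braid_class N v \<longleftrightarrow> braid_equiv N u v"
proof
  assume "braid_class N u = braid_class N v"
  moreover have "u \<in> braid_class N u"
    using assms by (simp add: braid_class_def braid_equiv.refl)
  ultimately have "braid_equiv N v u" by (simp add: braid_class_def)
  then show "braid_equiv N u v" by (rule braid_equiv.sym)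
next
  assume uv: "braid_equiv N u v"
  have "braid_equiv N u w \<longleftrightarrow> braid_equiv N v w" for w
    using braid_equiv.trans[OF uv, of w] braid_equiv.trans[OF braid_equiv.sym[OF uv], of w] by iprover
  then show "braid_class N u = braid_class N v"
    by (simp add: braid_class_def)
qed

lemma braid_mult_class:
  assumes "u \<in> braid_words N" "v \<in> braid_words N"
  shows "braid_class N u \<otimes>\<^bsub>braid_group N\<^esub> braid_class N v = braid_class N (u @ v)"
proof -
  have "braid_class N (u' @ v') = braid_class N (u @ v)"
    if "u' \<in> braid_class N u" "v' \<in> braid_class N v" for u' v'
  proof -
    have "braid_equiv N (u @ v) (u' @ v')"
      using that by (simp add: braid_class_def braid_equiv.cong)
    moreover have "u @ v \<in> braid_words N"
      using assms by (simp add: braid_words_def)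
    ultimately show ?thesis
      using braid_class_eq_iff by blast
  qed
  moreover have "u \<in> braid_class N u" "v \<in> braid_class N v"
    using assms by (simp_all add: braid_class_def braid_equiv.refl)
  ultimately have "(\<Union>u'\<in>braid_class N u. \<Union>v'\<in>braid_class N v. braid_class N (u' @ v'))
      = braid_class N (u @ v)"
    by blast
  then show ?thesis
    by (simp add: braid_group_def)
qed

lemma braid_inverse_word:
  "w \<in> braid_words N \<Longrightarrow> \<exists>w' \<in> braid_words N. braid_equiv N (w' @ w) []"
proof (induction w)
  case Nil
  then show ?case by (intro bexI[of _ "[]"]) (simp_all add: braid_words_def braid_equiv.refl)
next
  case (Cons a w)
  obtain i b where a: "a = (i, b)" by (cases a)
  have i: "i \<in> {1..<N}" and w: "w \<in> braid_words N"
    using Cons.prems a by (auto simp: braid_words_def)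
  obtain w' where w': "w' \<in> braid_words N" "braid_equiv N (w' @ w) []"
    using Cons.IH w by blast
  have "braid_equiv N ([(i, \<not> b), (i, b)] @ w) ([] @ w)"
    using braid_equiv.cancel[OF i, of "\<not> b"] w braid_equiv.cong braid_equiv.refl by fastforce
  then have "braid_equiv N (w' @ ([(i, \<not> b), (i, b)] @ w)) (w' @ ([] @ w))"
    by (intro braid_equiv.cong[OF braid_equiv.refl[OF w'(1)]])
  then have "braid_equiv N ((w' @ [(i, \<not> b)]) @ a # w) []"
    using braid_equiv.trans[OF _ w'(2)] a by simp
  moreover have "w' @ [(i, \<not> b)] \<in> braid_words N"
    using w' i by (auto simp: braid_words_def)
  ultimately show ?case by blast
qed

lemma group_braid_group: "group (braid_group N)"
proof (rule groupI)
  have nil: "[] \<in> braid_words N" by (simp add: braid_words_def)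
  have app: "u @ v \<in> braid_words N" if "u \<in> braid_words N" "v \<in> braid_words N" for u v
    using that by (simp add: braid_words_def)
  have car: "carrier (braid_group N) = braid_class N ` braid_words N"
    and one: "\<one>\<^bsub>braid_group N\<^esub> = braid_class N []"
    by (simp_all add: braid_group_def)
  show "\<one>\<^bsub>braid_group N\<^esub> \<in> carrier (braid_group N)"
    using nil by (simp add: car one)
  fix x assume "x \<in> carrier (braid_group N)"
  then obtain u where u: "u \<in> braid_words N" "x = braid_class N u" by (auto simp: car)
  show "\<one>\<^bsub>braid_group N\<^esub> \<otimes>\<^bsub>braid_group N\<^esub> x = x"
    using u nil by (simp add: one braid_mult_class)
  obtain u' where "u' \<in> braid_words N" "braid_equiv N (u' @ u) []"
    using braid_inverse_word u by blast
  then show "\<exists>y\<in>carrier (braid_group N). y \<otimes>\<^bsub>braid_group N\<^esub> x = \<one>\<^bsub>braid_group N\<^esub>"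
    using u app by (auto simp: car one braid_mult_class braid_class_eq_iff)
  fix y assume "y \<in> carrier (braid_group N)"
  then obtain v where v: "v \<in> braid_words N" "y = braid_class N v" by (auto simp: car)
  show "x \<otimes>\<^bsub>braid_group N\<^esub> y \<in> carrier (braid_group N)"
    using u v app by (auto simp: car braid_mult_class)
  fix z assume "z \<in> carrier (braid_group N)"
  then obtain w where w: "w \<in> braid_words N" "z = braid_class N w" by (auto simp: car)
  show "x \<otimes>\<^bsub>braid_group N\<^esub> y \<otimes>\<^bsub>braid_group N\<^esub> z = x \<otimes>\<^bsub>braid_group N\<^esub> (y \<otimes>\<^bsub>braid_group N\<^esub> z)"
    using u v w app by (simp add: braid_mult_class)
qed

definition sigma :: "nat \<Rightarrow> nat \<Rightarrow> braid" where
  "sigma N i = braid_class N [(i, True)]"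

definition braid_prod :: "nat \<Rightarrow> braid list \<Rightarrow> braid" where
  "braid_prod N xs = foldr (mult (braid_group N)) xs \<one>\<^bsub>braid_group N\<^esub>"

inductive_set positive_braids :: "nat \<Rightarrow> braid set" for N :: nat where
  one: "\<one>\<^bsub>braid_group N\<^esub> \<in> positive_braids N"
| gen: "i \<in> {1..<N} \<Longrightarrow> sigma N i \<in> positive_braids N"
| mult: "x \<in> positive_braids N \<Longrightarrow> y \<in> positive_braids N \<Longrightarrow>
    x \<otimes>\<^bsub>braid_group N\<^esub> y \<in> positive_braids N"

definition braid_order :: "nat \<Rightarrow> braid gorder" where
  "braid_order N =
    \<lparr>carrier = carrier (braid_group N),
     eq = (=),
     le = (\<lambda>a b. inv\<^bsub>braid_group N\<^esub> a \<otimes>\<^bsub>braid_group N\<^esub> b \<in> positive_braids N)\<rparr>"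

definition braid_meet :: "nat \<Rightarrow> braid \<Rightarrow> braid \<Rightarrow> braid" where
  "braid_meet N a b = a \<sqinter>\<^bsub>braid_order N\<^esub> b"

text \<open>The block with index \<open>i\<close> is \<open>\<sigma>\<^sub>i \<sigma>\<^sub>i\<^sub>-\<^sub>1 \<dots> \<sigma>\<^sub>1\<close>.\<close>

definition garside_Delta :: "nat \<Rightarrow> braid" where
  "garside_Delta N =
    braid_prod N (map (\<lambda>i. braid_prod N (map (sigma N) (rev [1..<Suc i]))) [1..<N])"

definition left_normal_form :: "nat \<Rightarrow> braid \<Rightarrow> int \<Rightarrow> braid list \<Rightarrow> bool" where
  "left_normal_form N x p xs \<longleftrightarrow>
    set xs \<subseteq> carrier (braid_group N) \<and>
    x = garside_Delta N [^]\<^bsub>braid_group N\<^esub> p \<otimes>\<^bsub>braid_group N\<^esub> braid_prod N xs \<and>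
    garside_Delta N [^]\<^bsub>braid_group N\<^esub> (- p) \<otimes>\<^bsub>braid_group N\<^esub> x \<in> positive_braids N \<and>
    (\<forall>q::int. garside_Delta N [^]\<^bsub>braid_group N\<^esub> (- q) \<otimes>\<^bsub>braid_group N\<^esub> x \<in> positive_braids N
       \<longrightarrow> q \<le> p) \<and>
    (\<forall>i<length xs. xs ! i \<noteq> \<one>\<^bsub>braid_group N\<^esub> \<and>
       xs ! i = braid_meet N (braid_prod N (drop i xs)) (garside_Delta N))"

definition braid_inf :: "nat \<Rightarrow> braid \<Rightarrow> int" where
  "braid_inf N x = (THE p. \<exists>xs. left_normal_form N x p xs)"

definition canonical_length :: "nat \<Rightarrow> braid \<Rightarrow> nat" where
  "canonical_length N x = (THE r. \<exists>p xs. left_normal_form N x p xs \<and> length xs = r)"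

definition initial_factor :: "nat \<Rightarrow> braid \<Rightarrow> braid" where
  "initial_factor N x =
    braid_meet N
      (x \<otimes>\<^bsub>braid_group N\<^esub> garside_Delta N [^]\<^bsub>braid_group N\<^esub> (- braid_inf N x))
      (garside_Delta N)"

definition preferred_prefix :: "nat \<Rightarrow> braid \<Rightarrow> braid" where
  "preferred_prefix N x =
    braid_meet N (initial_factor N x) (initial_factor N (inv\<^bsub>braid_group N\<^esub> x))"

definition cyclic_sliding :: "nat \<Rightarrow> braid \<Rightarrow> braid" where
  "cyclic_sliding N x =
    inv\<^bsub>braid_group N\<^esub> (preferred_prefix N x) \<otimes>\<^bsub>braid_group N\<^esub> x
      \<otimes>\<^bsub>braid_group N\<^esub> preferred_prefix N x"

definition in_sliding_circuit :: "nat \<Rightarrow> braid \<Rightarrow> bool" where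
  "in_sliding_circuit N y \<longleftrightarrow> (\<exists>m>0. (cyclic_sliding N ^^ m) y = y)"

definition sliding_circuits :: "nat \<Rightarrow> braid \<Rightarrow> braid set" where
  "sliding_circuits N x =
    {y. (\<exists>c\<in>carrier (braid_group N).
           y = inv\<^bsub>braid_group N\<^esub> c \<otimes>\<^bsub>braid_group N\<^esub> x \<otimes>\<^bsub>braid_group N\<^esub> c) \<and>
        in_sliding_circuit N y}"

end

(*
Idea. The interior part of beta is Delta_n^(2k) delta with delta = s_1 ... s_(n-1), since
delta^n = Delta_n^2. If Z is a positive braid on the first n strands with Delta_n | Z | Delta_n^(4k),
then the preferred prefix of Z s_(n+1)^(4k+1) is Delta_n: the long power of s_(n+1) keeps the last
factor of the normal form free of the first n strands, so nothing obstructs the prefix Delta_n.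
Hence sliding conjugates Z by Delta_n, and two slidings return to the start. It remains to count the
conjugates Z of Delta_n^(2k) delta in this range. Take Z = Delta_n^(2k) a^(-1) C a with C one of the
2^(n-2) Coxeter elements and a a product of 2k - 1 chains s_l ... s_m, the last letter of each chain
being the first letter of the next; there are (n-1)^(2k-1) such a once the first letter is fixed. With
the first letter chosen according to C, a and C a have no common left divisor, so the
reduced fraction a^(-1) (C a) determines a and C.
*)

theory Submission
  imports Defs
begin

section \<open>Positive braids\<close>

text \<open>The statement concerns a presented group whose meets are greatest lower bounds over all
  group elements, so its divisibility questions are first settled in the positive braid monoid.
  There Garside's reduction lemma yields cancellation, lcms and gcds; centrality of the full twist
  then embeds the monoid in the group, and meets of positive braids become gcds. Indices count
  generators: \<open>t = n - 1\<close>, \<open>T = n + 1\<close>, \<open>N = T + 1\<close>, and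
  \<open>delta t\<close> is the half twist on n strands. The constants fit as follows. A product
  \<open>a\<close> of m = 2k - 1 chains divides the m-th power of the half twist; if
  \<open>a'\<close> is its complement, then Z = a' Delta C a. One spare half twist can be moved to
  the front, and Z divides the power m + 1 + 1 + m = 4k. The exponent 4k + 1 of the last generator
  exceeds this by one, which leaves room for one more half twist behind Z; that room puts the half
  twist into the initial factor of the inverse. The letter \<open>t + 1\<close> between the two
  blocks never occurs, so the blocks commute and none of these braids is divisible by the half twist
  of the whole group.\<close>

definition far :: "nat \<Rightarrow> nat \<Rightarrow> bool" where
  "far i j \<longleftrightarrow> i + 2 \<le> j \<or> j + 2 \<le> i"

definition adj :: "nat \<Rightarrow> nat \<Rightarrow> bool" where
  "adj i j \<longleftrightarrow> j = Suc i \<or> i = Suc j"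

lemma far_sym: "far i j \<Longrightarrow> far j i"
  and adj_sym: "adj i j \<Longrightarrow> adj j i"
  by (auto simp: far_def adj_def)

lemma letter_cases: obtains "i = j" | "far i j" | "adj i j"
  unfolding far_def adj_def by linarith

text \<open>Since \<open>far\<close> and \<open>adj\<close> are symmetric, each relation is
  available in both directions, and the reflexive transitive closure \<open>peq\<close> is already
  an equivalence.\<close>

inductive pstep :: "nat list \<Rightarrow> nat list \<Rightarrow> bool" where
  far: "far i j \<Longrightarrow> pstep (u @ [i, j] @ v) (u @ [j, i] @ v)"
| adj: "adj i j \<Longrightarrow> pstep (u @ [i, j, i] @ v) (u @ [j, i, j] @ v)"

abbreviation peq :: "nat list \<Rightarrow> nat list \<Rightarrow> bool" where
  "peq \<equiv> pstep\<^sup>*\<^sup>*"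

lemma pstep_sym: "pstep v w \<Longrightarrow> pstep w v"
proof (induction rule: pstep.induct)
  case (far i j u v)
  then show ?case using pstep.far[OF far_sym] by blast
next
  case (adj i j u v)
  then show ?case using pstep.adj[OF adj_sym] by blast
qed

lemma peq_sym: "peq v w \<Longrightarrow> peq w v"
  by (rule sympD[OF symp_rtranclp]) (auto intro: sympI pstep_sym)

lemma pstep_append: "pstep v w \<Longrightarrow> pstep (s @ v @ t) (s @ w @ t)"
proof (induction rule: pstep.induct)
  case (far i j u v)
  then show ?case using pstep.far[of i j "s @ u" "v @ t"] by simp
next
  case (adj i j u v)
  then show ?case using pstep.adj[of i j "s @ u" "v @ t"] by simp
qed

lemma peq_append: "peq v w \<Longrightarrow> peq (s @ v @ t) (s @ w @ t)"
  by (induction rule: rtranclp_induct) (auto intro: rtranclp.intros pstep_append)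

lemma peq_append2: "peq u u' \<Longrightarrow> peq v v' \<Longrightarrow> peq (u @ v) (u' @ v')"
  using peq_append[of u u' "[]" v] peq_append[of v v' u' "[]"] by simp

text \<open>Both relations are homogeneous, use the same letters on both sides and remain relations
  when read backwards; so length, support and reversal descend to the quotient.\<close>

lemma pstep_invariants:
  "pstep v w \<Longrightarrow> length v = length w \<and> set v = set w \<and> pstep (rev v) (rev w)"
proof (induction rule: pstep.induct)
  case (far i j u v)
  then show ?case using pstep.far[of j i "rev v" "rev u"] by (auto simp: far_sym)
next
  case (adj i j u v)
  then show ?case using pstep.adj[of i j "rev v" "rev u"] by auto
qed

lemma peq_invariants:
  "peq v w \<Longrightarrow> length v = length w \<and> set v = set w \<and> peq (rev v) (rev w)"
  by (induction rule: rtranclp_induct)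
    (auto dest: pstep_invariants intro: rtranclp.intros)

\<comment> \<open>Letters range over all natural numbers. The number of strands is bounded only
  through \<open>supp\<close>, so half twists of different sizes live in one monoid.\<close>
quotient_type pbraid = "nat list" / peq
  by (intro equivpI reflpI sympI transpI) (auto intro: peq_sym rtranclp_trans)

lift_definition plen :: "pbraid \<Rightarrow> nat" is length by (simp add: peq_invariants)
lift_definition supp :: "pbraid \<Rightarrow> nat set" is set by (simp add: peq_invariants)
lift_definition reversal :: "pbraid \<Rightarrow> pbraid" is rev by (simp add: peq_invariants)
lift_definition pword :: "nat list \<Rightarrow> pbraid" is "\<lambda>w. w" .

instantiation pbraid :: monoid_mult
begin
lift_definition one_pbraid :: pbraid is "[]" .
lift_definition times_pbraid :: "pbraid \<Rightarrow> pbraid \<Rightarrow> pbraid" is "(@)"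
  by (rule peq_append2)
instance by standard (transfer; simp)+
end

definition gen :: "nat \<Rightarrow> pbraid" where "gen i = pword [i]"

lemma pword_Nil [simp]: "pword [] = 1" by transfer simp
lemma pword_append [simp]: "pword (u @ v) = pword u * pword v" by transfer simp
lemma pword_Cons [simp]: "pword (i # v) = gen i * pword v"
  unfolding gen_def by transfer simp
lemma pword_eq_iff: "pword u = pword v \<longleftrightarrow> peq u v" by transfer simp
lemma ex_pword: "\<exists>w. x = pword w" by transfer auto
lemma plen_one [simp]: "plen 1 = 0" by transfer simp
lemma plen_mult [simp]: "plen (x * y) = plen x + plen y" by transfer simp
lemma plen_gen [simp]: "plen (gen i) = 1" unfolding gen_def by transfer simp
lemma supp_one [simp]: "supp 1 = {}" by transfer simp
lemma supp_mult [simp]: "supp (x * y) = supp x \<union> supp y" by transfer simp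
lemma supp_gen [simp]: "supp (gen i) = {i}" unfolding gen_def by transfer simp
lemma supp_pword [simp]: "supp (pword w) = set w" by transfer simp
lemma reversal_one [simp]: "reversal 1 = 1" by transfer simp
lemma reversal_mult [simp]: "reversal (x * y) = reversal y * reversal x" by transfer simp
lemma reversal_gen [simp]: "reversal (gen i) = gen i" unfolding gen_def by transfer simp
lemma reversal_reversal [simp]: "reversal (reversal x) = x" by transfer simp
lemma plen_pword [simp]: "plen (pword w) = length w" by transfer simp

lemma pbraid_cases:
  obtains "x = 1" | i y where "x = gen i * y"
proof -
  obtain w where "x = pword w" using ex_pword by blast
  then show ?thesis using that by (cases w) auto
qed

lemma plen_eq_0: "plen x = 0 \<longleftrightarrow> x = 1"
proof
  assume "plen x = 0"
  then show "x = 1" by (cases x rule: pbraid_cases) auto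
qed simp

lemma gen_far: "far i j \<Longrightarrow> gen i * (gen j * z) = gen j * (gen i * z)"
proof -
  assume "far i j"
  then have "pword [i, j] = pword [j, i]"
    unfolding pword_eq_iff using pstep.far[of i j "[]" "[]"] by auto
  then show ?thesis by (simp flip: mult.assoc)
qed

lemma gen_adj: "adj i j \<Longrightarrow> gen i * (gen j * (gen i * z)) = gen j * (gen i * (gen j * z))"
proof -
  assume "adj i j"
  then have "pword [i, j, i] = pword [j, i, j]"
    unfolding pword_eq_iff using pstep.adj[of i j "[]" "[]"] by auto
  then show ?thesis by (simp flip: mult.assoc)
qed

section \<open>Garside's reduction lemma\<close>

definition reducible :: "nat \<Rightarrow> pbraid \<Rightarrow> nat \<Rightarrow> pbraid \<Rightarrow> bool" where
  "reducible a x b y \<longleftrightarrow> (a = b \<longrightarrow> x = y) \<and>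
    (far a b \<longrightarrow> (\<exists>w. x = gen b * w \<and> y = gen a * w)) \<and>
    (adj a b \<longrightarrow> (\<exists>w. x = gen b * (gen a * w) \<and> y = gen a * (gen b * w)))"

lemma reducible_eq: "reducible a x a y \<Longrightarrow> x = y"
  and reducible_far: "reducible a x b y \<Longrightarrow> far a b \<Longrightarrow> \<exists>w. x = gen b * w \<and> y = gen a * w"
  and reducible_adj: "reducible a x b y \<Longrightarrow> adj a b \<Longrightarrow>
      \<exists>w. x = gen b * (gen a * w) \<and> y = gen a * (gen b * w)"
  by (auto simp: reducible_def)

lemma reducible_sym: "reducible a x b y \<Longrightarrow> reducible b y a x"
  unfolding reducible_def by (blast dest: far_sym adj_sym)

lemma reducibleI_far: "far a b \<Longrightarrow> x = gen b * w \<Longrightarrow> y = gen a * w \<Longrightarrow> reducible a x b y"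
  by (auto simp: reducible_def far_def adj_def)

lemma reducibleI_adj:
  "adj a b \<Longrightarrow> x = gen b * (gen a * w) \<Longrightarrow> y = gen a * (gen b * w) \<Longrightarrow> reducible a x b y"
  by (auto simp: reducible_def far_def adj_def)

lemma reducible_refl: "reducible a x a x"
  by (auto simp: reducible_def far_def adj_def)

text \<open>The mixed overlap when two reductions are composed through \<open>gen c * z\<close>. The
  hypothesis \<open>H\<close> is the induction hypothesis for shorter braids; the mirrored overlap
  is obtained from this one by \<open>reducible_sym\<close>.\<close>

lemma reducible_trans_far_adj:
  assumes H: "\<And>a b x y. plen x < plen z \<Longrightarrow> gen a * x = gen b * y \<Longrightarrow> reducible a x b y"
    and A: "reducible a x c z" and B: "reducible c z b y" and ac: "far a c" and cb: "adj c b"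
  shows "reducible a x b y"
proof -
  obtain w where w: "x = gen c * w" "z = gen a * w" using reducible_far[OF A ac] by blast
  obtain v where v: "z = gen b * (gen c * v)" "y = gen c * (gen b * v)"
    using reducible_adj[OF B cb] by blast
  have R: "reducible a w b (gen c * v)" by (rule H) (simp add: w(2), metis w(2) v(1))
  show ?thesis
  proof (cases a b rule: letter_cases)
    case 1
    then show ?thesis using ac cb by (auto simp: far_def adj_def)
  next
    case 2
    obtain t where t: "w = gen b * t" "gen c * v = gen a * t" using reducible_far[OF R 2] by blast
    have R2: "reducible c v a t" by (rule H) (simp add: v(1), rule t(2))
    obtain s where s: "v = gen a * s" "t = gen c * s"
      using reducible_far[OF R2 far_sym[OF ac]] by blast
    show ?thesis
    proof (rule reducibleI_far[OF 2])
      show "x = gen b * (gen c * (gen b * s))" unfolding w(1) t(1) s(2) by (rule gen_adj[OF cb])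
      show "y = gen a * (gen c * (gen b * s))"
        unfolding v(2) s(1) by (subst gen_far[OF 2, symmetric]) (simp add: gen_far[OF ac])
    qed
  next
    \<comment> \<open>Here \<open>b\<close> is the middle one of three consecutive letters, and both
      sides complete to a multiple of the half twist on four strands, a word of length six.\<close>
    case 3
    obtain t where t: "w = gen b * (gen a * t)" "gen c * v = gen a * (gen b * t)"
      using reducible_adj[OF R 3] by blast
    have R2: "reducible c v a (gen b * t)" by (rule H) (simp add: v(1), rule t(2))
    obtain s where s: "v = gen a * s" "gen b * t = gen c * s"
      using reducible_far[OF R2 far_sym[OF ac]] by blast
    have R2: "reducible b t c s" by (rule H) (simp add: w(2) t(1), rule s(2))
    obtain u where u: "t = gen c * (gen b * u)" "s = gen b * (gen c * u)"
      using reducible_adj[OF R2 adj_sym[OF cb]] by blast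
    note F = gen_far[OF ac] gen_far[OF far_sym[OF ac]] gen_adj[OF 3] gen_adj[OF adj_sym[OF 3]]
      gen_adj[OF cb] gen_adj[OF adj_sym[OF cb]]
    show ?thesis
    proof (rule reducibleI_adj[OF 3])
      have "gen c * (gen b * (gen a * (gen c * (gen b * u))))
          = gen c * (gen b * (gen c * (gen a * (gen b * u))))" by (subst F(1)) simp
      also have "\<dots> = gen b * (gen c * (gen b * (gen a * (gen b * u))))" by (subst F(5)) simp
      also have "\<dots> = gen b * (gen c * (gen a * (gen b * (gen a * u))))" by (subst F(4)) simp
      also have "\<dots> = gen b * (gen a * (gen c * (gen b * (gen a * u))))" by (subst F(1)) simp
      finally show "x = gen b * (gen a * (gen c * (gen b * (gen a * u))))"
        unfolding w(1) t(1) u(1) .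
      have "gen c * (gen b * (gen a * (gen b * (gen c * u))))
          = gen c * (gen a * (gen b * (gen a * (gen c * u))))" by (subst F(4)) simp
      also have "\<dots> = gen a * (gen c * (gen b * (gen a * (gen c * u))))" by (subst F(1)) simp
      also have "\<dots> = gen a * (gen c * (gen b * (gen c * (gen a * u))))" by (subst F(1)) simp
      also have "\<dots> = gen a * (gen b * (gen c * (gen b * (gen a * u))))" by (subst F(5)) simp
      finally show "y = gen a * (gen b * (gen c * (gen b * (gen a * u))))"
        unfolding v(2) s(1) u(2) .
    qed
  qed
qed

text \<open>When \<open>c\<close> differs from \<open>a\<close> and \<open>b\<close>, the two
  reductions give two factorisations of the shorter braid \<open>z\<close>; \<open>H\<close>
  compares these, and the outcome is translated back to \<open>x\<close> and
  \<open>y\<close>.\<close>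

lemma reducible_trans:
  assumes H: "\<And>a b x y. plen x < plen z \<Longrightarrow> gen a * x = gen b * y \<Longrightarrow> reducible a x b y"
    and A: "reducible a x c z" and B: "reducible c z b y"
  shows "reducible a x b y"
proof (cases a c rule: letter_cases)
  case 1
  then show ?thesis using reducible_eq[of a x] A B reducible_eq[of b z] by metis
next
  case ac: 2
  show ?thesis
  proof (cases c b rule: letter_cases)
    case 1
    then show ?thesis using reducible_eq[of a x] A B reducible_eq[of b z] by metis
  next
    case cb: 2
    obtain w where w: "x = gen c * w" "z = gen a * w" using reducible_far[OF A ac] by blast
    obtain v where v: "z = gen b * v" "y = gen c * v" using reducible_far[OF B cb] by blast
    have R: "reducible a w b v" by (rule H) (simp add: w(2), metis w(2) v(1))
    show ?thesis
    proof (cases a b rule: letter_cases)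
      case 1
      then have "w = v" using R reducible_eq by simp
      then show ?thesis using 1 w v reducible_refl by simp
    next
      case 2
      obtain t where t: "w = gen b * t" "v = gen a * t" using reducible_far[OF R 2] by blast
      show ?thesis
        by (rule reducibleI_far[OF 2, of _ "gen c * t"])
          (unfold w(1) v(2) t, simp_all only: gen_far[OF cb] gen_far[OF far_sym[OF ac]])
    next
      case 3
      obtain t where t: "w = gen b * (gen a * t)" "v = gen a * (gen b * t)"
        using reducible_adj[OF R 3] by blast
      show ?thesis
        by (rule reducibleI_adj[OF 3, of _ "gen c * t"])
          (unfold w(1) v(2) t, simp_all only: gen_far[OF cb] gen_far[OF far_sym[OF ac]])
    qed
  next
    case 3
    then show ?thesis using reducible_trans_far_adj[OF H A B ac] by blast
  qed
next
  case ac: 3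
  show ?thesis
  proof (cases c b rule: letter_cases)
    case 1
    then show ?thesis using reducible_eq[of a x] A B reducible_eq[of b z] by metis
  next
    case 2
    then show ?thesis
      using reducible_trans_far_adj[OF H reducible_sym[OF B] reducible_sym[OF A]]
        far_sym adj_sym[OF ac] reducible_sym by blast
  next
    case cb: 3
    obtain w where w: "x = gen c * (gen a * w)" "z = gen a * (gen c * w)"
      using reducible_adj[OF A ac] by blast
    obtain v where v: "z = gen b * (gen c * v)" "y = gen c * (gen b * v)"
      using reducible_adj[OF B cb] by blast
    have R: "reducible a (gen c * w) b (gen c * v)" by (rule H) (simp add: w(2), metis w(2) v(1))
    show ?thesis
    proof (cases a b rule: letter_cases)
      case 1
      have "reducible c w c v"
        by (rule H) (simp add: w(2), use R 1 reducible_eq in simp)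
      then have "w = v" by (rule reducible_eq)
      then show ?thesis using 1 w v reducible_refl by simp
    next
      \<comment> \<open>Now \<open>c\<close> lies between \<open>a\<close> and \<open>b\<close>; the
        common multiple is again a multiple of the half twist on four strands.\<close>
      case 2
      obtain t where t: "gen c * w = gen b * t" "gen c * v = gen a * t"
        using reducible_far[OF R 2] by blast
      have R2: "reducible c w b t" by (rule H) (simp add: w(2), rule t(1))
      obtain s where s: "w = gen b * (gen c * s)" "t = gen c * (gen b * s)"
        using reducible_adj[OF R2 cb] by blast
      have R2: "reducible c v a t" by (rule H) (simp add: v(1), rule t(2))
      obtain s' where s': "v = gen a * (gen c * s')" "t = gen c * (gen a * s')"
        using reducible_adj[OF R2 adj_sym[OF ac]] by blast
      have "reducible c (gen b * s) c (gen a * s')"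
        by (rule H) (simp add: w(2) s(1), metis s(2) s'(2))
      then have "gen b * s = gen a * s'" by (rule reducible_eq)
      then have R2: "reducible b s a s'" by (intro H) (simp_all add: w(2) s(1))
      obtain u where u: "s = gen a * u" "s' = gen b * u"
        using reducible_far[OF R2 far_sym[OF 2]] by blast
      note F = gen_far[OF 2] gen_adj[OF ac] gen_adj[OF cb]
      show ?thesis
      proof (rule reducibleI_far[OF 2])
        have "gen c * (gen a * (gen b * (gen c * (gen a * u))))
            = gen c * (gen b * (gen a * (gen c * (gen a * u))))" by (subst F(1)) simp
        also have "\<dots> = gen c * (gen b * (gen c * (gen a * (gen c * u))))" by (subst F(2)) simp
        also have "\<dots> = gen b * (gen c * (gen b * (gen a * (gen c * u))))" by (subst F(3)) simp
        also have "\<dots> = gen b * (gen c * (gen a * (gen b * (gen c * u))))" by (subst F(1)) simp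
        finally show "x = gen b * (gen c * (gen a * (gen b * (gen c * u))))"
          unfolding w(1) s(1) u(1) .
        have "gen c * (gen b * (gen a * (gen c * (gen b * u))))
            = gen c * (gen a * (gen b * (gen c * (gen b * u))))" by (subst F(1)) simp
        also have "\<dots> = gen c * (gen a * (gen c * (gen b * (gen c * u))))" by (subst F(3)) simp
        also have "\<dots> = gen a * (gen c * (gen a * (gen b * (gen c * u))))" by (subst F(2)) simp
        finally show "y = gen a * (gen c * (gen a * (gen b * (gen c * u))))"
          unfolding v(2) s'(1) u(2) .
      qed
    next
      case 3
      \<comment> \<open>Two letters adjacent to \<open>c\<close> differ by 0 or 2, so they are not
        adjacent to each other.\<close>
      then show ?thesis using ac cb by (auto simp: adj_def)
    qed
  qed
qed

lemma pstep_Cons_reducible: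
  assumes "pstep (c # Z) (b # Y)"
  shows "reducible c (pword Z) b (pword Y)"
  using assms
proof (cases rule: pstep.cases)
  case (far i j u v)
  show ?thesis
  proof (cases u)
    case Nil
    then show ?thesis using far by (auto intro: reducibleI_far)
  next
    case (Cons h u')
    then have "pstep Z Y" using pstep.far[of i j u' v] far by auto
    then have "pword Z = pword Y" unfolding pword_eq_iff by blast
    then show ?thesis using far Cons reducible_refl by simp
  qed
next
  case (adj i j u v)
  show ?thesis
  proof (cases u)
    case Nil
    then show ?thesis using adj by (auto intro: reducibleI_adj)
  next
    case (Cons h u')
    then have "pstep Z Y" using pstep.adj[of i j u' v] adj by auto
    then have "pword Z = pword Y" unfolding pword_eq_iff by blast
    then show ?thesis using adj Cons reducible_refl by simp
  qed
qed

text \<open>An equation between positive braids with first letters \<open>a\<close> and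
  \<open>b\<close> factors through the lcm of these letters. The outer induction is on length, the
  inner one on the number of elementary steps; every intermediate word begins with some
  \<open>c\<close>, and \<open>reducible_trans\<close> joins the reductions on its two
  sides.\<close>

lemma gen_mult_eqD: "gen a * x = gen b * y \<Longrightarrow> reducible a x b y"
proof (induction "plen x" arbitrary: a b x y rule: less_induct)
  case less
  obtain X Y where XY: "x = pword X" "y = pword Y" using ex_pword by metis
  have "peq (a # X) (b # Y)"
    using less.prems XY by (simp flip: pword_eq_iff)
  moreover have "peq (a # X) w \<Longrightarrow> w = b # Y \<Longrightarrow> reducible a (pword X) b (pword Y)" for w b Y
  proof (induction arbitrary: b Y rule: rtranclp_induct)
    case base
    then show ?case by (auto simp: reducible_refl)
  next
    case (step w w')
    have len: "length w = length (a # X)" using peq_invariants[OF step.hyps(1)] by simp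
    then obtain c Z where w: "w = c # Z" by (cases w) auto
    have B: "reducible c (pword Z) b (pword Y)"
      using step.hyps(2) step.prems w pstep_Cons_reducible by blast
    show ?case
      by (rule reducible_trans[OF _ step.IH[OF w] B])
        (use len w XY less.hyps in auto)
  qed
  ultimately show ?case using XY by blast
qed

section \<open>Divisibility and the half twist\<close>

text \<open>The case of equal first letters in Garside's lemma, applied letter by letter;
  \<open>reversal\<close> then transports it to the other side.\<close>

lemma pbraid_left_cancel [simp]: "x * y = x * z \<longleftrightarrow> y = (z :: pbraid)"
proof
  have "pword w * y = pword w * z \<Longrightarrow> y = z" for w
  proof (induction w)
    case (Cons i w)
    then show ?case using reducible_eq[OF gen_mult_eqD[of i "pword w * y" i "pword w * z"]]
      by (simp add: mult.assoc)
  qed simp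
  then show "x * y = x * z \<Longrightarrow> y = z" using ex_pword by metis
qed simp

lemma pbraid_right_cancel [simp]: "y * x = z * x \<longleftrightarrow> y = (z :: pbraid)"
  by (metis pbraid_left_cancel reversal_mult reversal_reversal)

lemma pbraid_mult_eq_1: "x * y = (1 :: pbraid) \<Longrightarrow> x = 1 \<and> y = 1"
  by (metis add_is_0 plen_eq_0 plen_mult plen_one)

definition ldvd :: "pbraid \<Rightarrow> pbraid \<Rightarrow> bool" (infix \<open>ldvd\<close> 50) where
  "x ldvd y \<longleftrightarrow> (\<exists>z. y = x * z)"

lemma ldvd_triv [simp]: "x ldvd x * y" by (auto simp: ldvd_def)
lemma ldvd_refl [simp]: "x ldvd x" using ldvd_triv[of x 1] by simp
lemma one_ldvd [simp]: "1 ldvd x" using ldvd_triv[of 1 x] by simp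
lemma ldvd_trans: "x ldvd y \<Longrightarrow> y ldvd z \<Longrightarrow> x ldvd z"
  by (metis ldvd_def mult.assoc)
lemma ldvd_mult_right: "x ldvd y \<Longrightarrow> x ldvd y * z"
  using ldvd_trans ldvd_triv by blast
lemma mult_ldvd_cancel [simp]: "x * y ldvd x * z \<longleftrightarrow> y ldvd z"
  by (simp add: ldvd_def mult.assoc)
lemma mult_ldvd_left: "x * y ldvd z \<Longrightarrow> x ldvd z"
  using ldvd_trans ldvd_triv by blast
lemma ldvd_plen: "x ldvd y \<Longrightarrow> plen x \<le> plen y" by (auto simp: ldvd_def)
lemma ldvd_supp: "x ldvd y \<Longrightarrow> supp x \<subseteq> supp y" by (auto simp: ldvd_def)

lemma ldvd_antisym: "x ldvd y \<Longrightarrow> y ldvd x \<Longrightarrow> x = y"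
proof -
  assume "x ldvd y" "y ldvd x"
  then obtain u v where "y = x * u" "x = y * v" by (auto simp: ldvd_def)
  then have "x * (u * v) = x * 1" by (simp flip: mult.assoc)
  then have "u * v = 1" by (simp only: pbraid_left_cancel)
  then show "x = y" using pbraid_mult_eq_1[of u v] \<open>y = x * u\<close> by simp
qed

lemma gen_ldvd_far:
  assumes "far i j" "gen j ldvd gen i * x"
  shows "gen j ldvd x"
proof -
  obtain z where "gen i * x = gen j * z" using assms(2) by (auto simp: ldvd_def)
  then show ?thesis using reducible_far[OF gen_mult_eqD assms(1)] by force
qed

lemma gen_ldvd_adj:
  assumes "adj i j" "gen j ldvd gen i * x"
  shows "gen j * gen i ldvd x"
proof -
  obtain z where "gen i * x = gen j * z" using assms(2) by (auto simp: ldvd_def)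
  then obtain w where "x = gen j * (gen i * w)"
    using reducible_adj[OF gen_mult_eqD assms(1)] by blast
  then show ?thesis by (auto simp flip: mult.assoc)
qed

text \<open>Every letter of \<open>v\<close> differs from \<open>j\<close>, and whether it is far
  from or adjacent to \<open>j\<close>, the divisor \<open>gen j\<close> survives its
  removal.\<close>

lemma gen_ldvd_skip:
  assumes "j \<notin> supp v" "gen j ldvd v * x"
  shows "gen j ldvd x"
proof -
  have "j \<notin> set w \<Longrightarrow> gen j ldvd pword w * x \<Longrightarrow> gen j ldvd x" for w
  proof (induction w)
    case (Cons i w)
    then have *: "gen j ldvd gen i * (pword w * x)" by (simp add: mult.assoc)
    show ?case
    proof (cases i j rule: letter_cases)
      case 2
      then show ?thesis using Cons gen_ldvd_far[OF 2 *] by simp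
    next
      case 3
      then show ?thesis using Cons mult_ldvd_left[OF gen_ldvd_adj[OF 3 *]] by simp
    qed (use Cons in simp)
  qed simp
  then show ?thesis using assms ex_pword[of v] by auto
qed

definition is_lcm :: "pbraid \<Rightarrow> pbraid \<Rightarrow> pbraid \<Rightarrow> bool" where
  "is_lcm u v l \<longleftrightarrow> u ldvd l \<and> v ldvd l \<and> (\<forall>z. u ldvd z \<longrightarrow> v ldvd z \<longrightarrow> l ldvd z)"

lemma ex_lcm_gen:
  assumes "gen a * x = gen b * y"
  shows "\<exists>p q. is_lcm (gen a) (gen b) (gen a * p) \<and> gen a * p = gen b * q"
proof (cases a b rule: letter_cases)
  case 1
  have "is_lcm (gen a) (gen a) (gen a * 1)" by (auto simp: is_lcm_def)
  then show ?thesis using 1 by blast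
next
  case 2
  have "gen a * gen b = gen b * gen a" using gen_far[OF 2, of 1] by simp
  moreover have "gen a * gen b ldvd z" if z: "gen a ldvd z" "gen b ldvd z" for z
  proof -
    obtain s t where "z = gen a * s" "z = gen b * t" using z unfolding ldvd_def by blast
    then obtain w where "z = gen a * (gen b * w)" using reducible_far[OF gen_mult_eqD 2, of s t] by auto
    then show ?thesis by (simp flip: mult.assoc)
  qed
  ultimately have "is_lcm (gen a) (gen b) (gen a * gen b)"
    using ldvd_triv[of "gen a" "gen b"] ldvd_triv[of "gen b" "gen a"] by (simp add: is_lcm_def)
  then show ?thesis using \<open>gen a * gen b = gen b * gen a\<close> by blast
next
  case 3
  have eq: "gen a * (gen b * gen a) = gen b * (gen a * gen b)" using gen_adj[OF 3, of 1] by simp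
  moreover have "gen a * (gen b * gen a) ldvd z" if z: "gen a ldvd z" "gen b ldvd z" for z
  proof -
    obtain s t where "z = gen a * s" "z = gen b * t" using z unfolding ldvd_def by blast
    then obtain w where "z = gen a * (gen b * (gen a * w))"
      using reducible_adj[OF gen_mult_eqD 3, of s t] by auto
    then show ?thesis by (simp flip: mult.assoc)
  qed
  ultimately have "is_lcm (gen a) (gen b) (gen a * (gen b * gen a))"
    using ldvd_triv[of "gen b" "gen a * gen b"] ldvd_triv[of "gen a" "gen b * gen a"]
    by (simp add: is_lcm_def)
  then show ?thesis using eq by blast
qed

text \<open>Split off the first letters \<open>a\<close> and \<open>b\<close>, with lcm
  \<open>gen a * p = gen b * q\<close>. The lcms of \<open>u'\<close> with \<open>p\<close> and of
  \<open>v'\<close> with \<open>q\<close> leave complements \<open>r\<close> and \<open>s\<close>,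
  whose lcm closes the diagram. Each of these three lcms has a common multiple shorter than
  \<open>x\<close>.\<close>

lemma ex_lcm:
  assumes "u ldvd x" "v ldvd x"
  shows "\<exists>l. is_lcm u v l"
  using assms
proof (induction "plen x" arbitrary: x u v rule: less_induct)
  case less
  show ?case
  proof (cases u rule: pbraid_cases)
    case 1
    then have "is_lcm u v v" by (simp add: is_lcm_def)
    then show ?thesis ..
  next
    case u: (2 a u')
    show ?thesis
    proof (cases v rule: pbraid_cases)
      case 1
      then have "is_lcm u v u" by (simp add: is_lcm_def)
      then show ?thesis ..
    next
      case v: (2 b v')
      obtain x1 where x1: "x = gen a * x1" "u' ldvd x1"
        using less.prems(1) u by (auto simp: ldvd_def mult.assoc)
      obtain x2 where x2: "x = gen b * x2" "v' ldvd x2"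
        using less.prems(2) v by (auto simp: ldvd_def mult.assoc)
      obtain p q where pq: "is_lcm (gen a) (gen b) (gen a * p)" "gen a * p = gen b * q"
        using ex_lcm_gen x1(1) x2(1) by metis
      have "gen a * p ldvd x" using pq(1) x1(1) x2(1) ldvd_triv unfolding is_lcm_def by metis
      then obtain x3 where x3: "x = gen a * p * x3" by (auto simp: ldvd_def)
      have x13: "x1 = p * x3" using x3 x1(1) by (simp add: mult.assoc)
      have x23: "x2 = q * x3" using x3 x2(1) pq(2) by (simp add: mult.assoc)
      have "plen x1 < plen x" by (simp add: x1(1))
      moreover have "plen x2 < plen x" by (simp add: x2(1))
      ultimately
      obtain m1 m2 where m1: "is_lcm u' p m1" and m2: "is_lcm v' q m2"
        using less.hyps[of x1 u' p] less.hyps[of x2 v' q] x1(2) x2(2) x13 x23 ldvd_triv by metis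
      obtain r where r: "m1 = p * r" using m1 by (auto simp: is_lcm_def ldvd_def)
      obtain s where s: "m2 = q * s" using m2 by (auto simp: is_lcm_def ldvd_def)
      have "p * r ldvd p * x3" "q * s ldvd q * x3"
        using m1 m2 x1(2) x2(2) r s ldvd_triv unfolding is_lcm_def x13 x23 by metis+
      then have rs: "r ldvd x3" "s ldvd x3" by simp_all
      have "plen x3 < plen x" using x3 by simp
      then obtain t where t: "is_lcm r s t" using less.hyps rs by blast
      have "is_lcm u v (gen a * p * t)"
        unfolding is_lcm_def
      proof (intro conjI allI impI)
        have "u ldvd gen a * m1" using u m1 by (simp add: is_lcm_def)
        then have "u ldvd gen a * p * r" by (simp add: r mult.assoc)
        then show "u ldvd gen a * p * t"
          using t by (meson is_lcm_def ldvd_trans mult_ldvd_cancel)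
        have "v ldvd gen b * m2" using v m2 by (simp add: is_lcm_def)
        then have "v ldvd gen a * p * s" by (simp add: pq(2) s mult.assoc)
        then show "v ldvd gen a * p * t"
          using t by (meson is_lcm_def ldvd_trans mult_ldvd_cancel)
      next
        fix z assume z: "u ldvd z" "v ldvd z"
        have "gen a * p ldvd z"
          using z u v pq(1) mult_ldvd_left unfolding is_lcm_def by blast
        then obtain z3 where z3: "z = gen a * p * z3" by (auto simp: ldvd_def)
        have "u' ldvd p * z3" using z(1) u z3 by (simp add: mult.assoc)
        then have "p * r ldvd p * z3" using m1 r ldvd_triv unfolding is_lcm_def by metis
        have "v' ldvd q * z3" using z(2) v z3 unfolding pq(2) by (simp add: mult.assoc)
        then have "q * s ldvd q * z3" using m2 s ldvd_triv unfolding is_lcm_def by metis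
        have "t ldvd z3"
          using \<open>p * r ldvd p * z3\<close> \<open>q * s ldvd q * z3\<close> t unfolding is_lcm_def by simp
        then show "gen a * p * t ldvd z" using z3 by simp
      qed
      then show ?thesis ..
    qed
  qed
qed

text \<open>A common divisor of greatest length works: its lcm with any other common divisor exists
  below \<open>x\<close>, is again a common divisor and is not longer, hence equal to it.\<close>

lemma ex_gcd:
  "\<exists>d. d ldvd x \<and> d ldvd y \<and> (\<forall>u. u ldvd x \<longrightarrow> u ldvd y \<longrightarrow> u ldvd d)"
proof -
  let ?P = "\<lambda>d. d ldvd x \<and> d ldvd y"
  obtain d where d: "?P d" "\<And>e. ?P e \<Longrightarrow> plen e \<le> plen d"
    using ex_has_greatest_nat[of ?P 1 plen "Suc (plen x)"] ldvd_plen by fastforce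
  have "u ldvd d" if u: "u ldvd x" "u ldvd y" for u
  proof -
    obtain l where l: "is_lcm u d l" using ex_lcm u(1) d(1) by blast
    then have "?P l" using u d(1) unfolding is_lcm_def by blast
    then have "plen l \<le> plen d" by (rule d(2))
    moreover obtain e where "l = d * e" using l by (auto simp: is_lcm_def ldvd_def)
    ultimately have "l = d" using plen_eq_0 by auto
    then show ?thesis using l by (simp add: is_lcm_def)
  qed
  then show ?thesis using d(1) by blast
qed

lemma supp_far_commute:
  assumes "\<And>i j. i \<in> supp x \<Longrightarrow> j \<in> supp y \<Longrightarrow> far i j"
  shows "x * y = y * x"
proof -
  have 1: "(\<And>j. j \<in> set w \<Longrightarrow> far i j) \<Longrightarrow> gen i * pword w = pword w * gen i" for i w
  proof (induction w)
    case (Cons j w)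
    have "gen i * (gen j * pword w) = gen j * (gen i * pword w)"
      by (rule gen_far) (simp add: Cons.prems)
    then show ?case using Cons by (simp add: mult.assoc)
  qed simp
  have "(\<And>i j. i \<in> set v \<Longrightarrow> j \<in> set w \<Longrightarrow> far i j) \<Longrightarrow> pword v * pword w = pword w * pword v" for v w
  proof (induction v)
    case (Cons i v)
    then have "gen i * pword w = pword w * gen i" "pword v * pword w = pword w * pword v"
      by (auto intro!: 1)
    then show ?case by (metis mult.assoc pword_Cons)
  qed simp
  then show ?thesis using assms ex_pword by (metis supp_pword)
qed

section \<open>The half twist and the divisors of its powers\<close>

definition up :: "nat \<Rightarrow> pbraid" where "up t = pword [1..<Suc t]"
definition down :: "nat \<Rightarrow> pbraid" where "down t = pword (rev [1..<Suc t])"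

text \<open>The argument counts generators: this is the half twist on \<open>t + 1\<close> strands,
  in the factorisation used by \<open>garside_Delta\<close>.\<close>

primrec delta :: "nat \<Rightarrow> pbraid" where
  "delta 0 = 1"
| "delta (Suc t) = delta t * down (Suc t)"

lemma up_0 [simp]: "up 0 = 1" and up_Suc: "up (Suc t) = up t * gen (Suc t)"
  by (simp_all add: up_def)
lemma down_0 [simp]: "down 0 = 1" and down_Suc: "down (Suc t) = gen (Suc t) * down t"
  by (simp_all add: down_def)
lemma reversal_up [simp]: "reversal (up t) = down t"
  by (induction t) (simp_all add: up_Suc down_Suc)
lemma supp_up [simp]: "supp (up t) = {1..t}" by (auto simp: up_def)
lemma supp_down [simp]: "supp (down t) = {1..t}" by (auto simp: down_def)
lemma supp_delta [simp]: "supp (delta t) = {1..t}" by (induction t) auto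

lemma up_gen:
  "1 \<le> i \<Longrightarrow> i < t \<Longrightarrow> up t * gen i = gen (Suc i) * up t"
proof (induction t)
  case (Suc t)
  show ?case
  proof (cases "i = t")
    case True
    obtain s where t: "t = Suc s" using Suc.prems True by (cases t) auto
    have A: "adj (Suc s) (Suc t)" using t by (simp add: adj_def)
    have "up (Suc t) * gen i = up s * (gen (Suc s) * (gen (Suc t) * (gen (Suc s) * 1)))"
      by (simp add: up_Suc t True mult.assoc)
    also have "\<dots> = (up s * gen (Suc t)) * (gen (Suc s) * gen (Suc t))"
      by (subst gen_adj[OF A]) (simp add: mult.assoc)
    also have "up s * gen (Suc t) = gen (Suc t) * up s"
      by (rule supp_far_commute) (auto simp: far_def t)
    also have "gen (Suc t) * up s * (gen (Suc s) * gen (Suc t)) = gen (Suc i) * up (Suc t)"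
      by (simp add: up_Suc t True mult.assoc)
    finally show ?thesis .
  next
    case False
    have "gen (Suc t) * gen i = gen i * gen (Suc t)"
      by (rule supp_far_commute) (use Suc.prems False in \<open>auto simp: far_def\<close>)
    then have "up (Suc t) * gen i = (up t * gen i) * gen (Suc t)"
      by (simp add: up_Suc mult.assoc)
    also have "up t * gen i = gen (Suc i) * up t" using Suc False by simp
    finally show ?thesis by (simp add: up_Suc mult.assoc)
  qed
qed simp

lemma gen_down: "1 \<le> i \<Longrightarrow> i < t \<Longrightarrow> gen i * down t = down t * gen (Suc i)"
  using arg_cong[OF up_gen, of i t reversal] by simp

text \<open>The mirrored factorisation. Having both makes the top generator accessible from either
  side, as \<open>gen_delta\<close> and \<open>coxeter_ldvd_delta\<close> require.\<close>

lemma delta_Suc_up: "delta (Suc t) = up (Suc t) * delta t"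
proof (induction t)
  case 0
  show ?case by (simp add: up_Suc down_Suc)
next
  case (Suc t)
  have "delta (Suc (Suc t)) = up (Suc t) * delta t * (gen (Suc (Suc t)) * down (Suc t))"
    by (subst delta.simps(2), subst Suc) (simp add: down_Suc)
  also have "\<dots> = up (Suc t) * (delta t * gen (Suc (Suc t))) * down (Suc t)"
    by (simp add: mult.assoc)
  also have "delta t * gen (Suc (Suc t)) = gen (Suc (Suc t)) * delta t"
    by (rule supp_far_commute) (auto simp: far_def)
  finally show ?case by (simp add: up_Suc mult.assoc)
qed

text \<open>Conjugation by the half twist reflects the generators. Letters up to \<open>t\<close>
  pass through \<open>delta t\<close> and are then shifted by \<open>down\<close>; the top letter
  has to enter through the factorisation with \<open>up\<close>.\<close>

lemma gen_delta:
  "1 \<le> i \<Longrightarrow> i \<le> t \<Longrightarrow> gen i * delta t = delta t * gen (Suc t - i)"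
proof (induction t arbitrary: i)
  case (Suc t)
  show ?case
  proof (cases "i \<le> t")
    case True
    have "gen i * delta (Suc t) = delta t * (gen (Suc t - i) * down (Suc t))"
      using Suc True by (simp flip: mult.assoc)
    also have "gen (Suc t - i) * down (Suc t) = down (Suc t) * gen (Suc (Suc t - i))"
      by (rule gen_down) (use Suc.prems True in auto)
    finally show ?thesis using True by (simp add: mult.assoc Suc_diff_le)
  next
    case i: False
    show ?thesis
    proof (cases "t = 0")
      case True
      then show ?thesis using i Suc.prems by (auto simp: down_Suc)
    next
      case False
      have "gen i * delta (Suc t) = gen (Suc t) * up (Suc t) * delta t"
        using i Suc.prems by (simp add: delta_Suc_up mult.assoc le_Suc_eq del: delta.simps)
      also have "gen (Suc t) * up (Suc t) = up (Suc t) * gen t"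
        using up_gen[of t "Suc t"] False by simp
      also have "up (Suc t) * gen t * delta t = up (Suc t) * (gen t * delta t)"
        by (simp add: mult.assoc)
      also have "gen t * delta t = delta t * gen 1"
        using Suc.IH[of t] False by simp
      finally show ?thesis
        using i Suc.prems delta_Suc_up[of t] by (simp add: mult.assoc le_Suc_eq del: delta.simps)
    qed
  qed
qed simp

text \<open>The braid \<open>x'\<close> is \<open>x\<close> with its letters reflected. Reflection
  is an involution, so a single \<open>x'\<close> serves both equations.\<close>

lemma ex_flip:
  assumes "supp x \<subseteq> {1..t}"
  shows "\<exists>x'. supp x' \<subseteq> {1..t} \<and> x * delta t = delta t * x' \<and> delta t * x = x' * delta t"
proof -
  have "set w \<subseteq> {1..t} \<Longrightarrow> \<exists>x'. supp x' \<subseteq> {1..t} \<and> pword w * delta t = delta t * x'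
      \<and> delta t * pword w = x' * delta t" for w
  proof (induction w)
    case Nil
    show ?case by (rule exI[of _ 1]) simp
  next
    case (Cons i w)
    then obtain x' where x': "supp x' \<subseteq> {1..t}" "pword w * delta t = delta t * x'"
        "delta t * pword w = x' * delta t" by auto
    have i: "1 \<le> i" "i \<le> t" using Cons.prems by auto
    let ?j = "Suc t - i"
    have 1: "gen i * delta t = delta t * gen ?j" using gen_delta[OF i] .
    have 2: "delta t * gen i = gen ?j * delta t" using gen_delta[of ?j t] i by simp
    show ?case
    proof (intro exI conjI)
      show "supp (gen ?j * x') \<subseteq> {1..t}" using x' i by auto
      show "pword (i # w) * delta t = delta t * (gen ?j * x')"
        using x'(2) 1 by (simp add: mult.assoc) (simp flip: mult.assoc)
      show "delta t * pword (i # w) = gen ?j * x' * delta t"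
        using x'(3) 2 by (simp add: mult.assoc) (metis mult.assoc)
    qed
  qed
  then show ?thesis using assms ex_pword[of x] by auto
qed

lemma ex_flip_power:
  assumes "supp x \<subseteq> {1..t}"
  shows "\<exists>x'. supp x' \<subseteq> {1..t} \<and> x * delta t ^ m = delta t ^ m * x'
    \<and> delta t ^ m * x = x' * delta t ^ m"
proof (induction m)
  case 0
  show ?case using assms by (intro exI[of _ x]) simp
next
  case (Suc m)
  then obtain y where y: "supp y \<subseteq> {1..t}" "x * delta t ^ m = delta t ^ m * y"
    "delta t ^ m * x = y * delta t ^ m" by blast
  obtain z where z: "supp z \<subseteq> {1..t}" "y * delta t = delta t * z" "delta t * y = z * delta t"
    using ex_flip[OF y(1)] by blast
  have "x * delta t ^ Suc m = delta t ^ Suc m * z"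
    by (metis mult.assoc power_Suc2 y(2) z(2))
  moreover have "delta t ^ Suc m * x = z * delta t ^ Suc m"
    by (metis mult.assoc power_Suc y(3) z(3))
  ultimately show ?case using z(1) by blast
qed

lemma delta_sq_central: "supp x \<subseteq> {1..t} \<Longrightarrow> x * delta t ^ (2 * k) = delta t ^ (2 * k) * x"
proof (induction k)
  case (Suc k)
  obtain x' where x': "x * delta t = delta t * x'" "delta t * x = x' * delta t"
    using ex_flip[OF Suc.prems] by blast
  have "x * (delta t * delta t) = delta t * x' * delta t"
    using x'(1) by (metis mult.assoc)
  also have "\<dots> = delta t * delta t * x" using x'(2) by (metis mult.assoc)
  finally have sq: "x * delta t ^ 2 = delta t ^ 2 * x" by (simp add: power2_eq_square)
  have "x * delta t ^ (2 * Suc k) = x * delta t ^ 2 * delta t ^ (2 * k)"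
    by (simp add: mult.assoc power_add flip: power_add)
  also have "\<dots> = delta t ^ 2 * (delta t ^ (2 * k) * x)" using Suc by (simp add: sq mult.assoc)
  also have "\<dots> = delta t ^ (2 * Suc k) * x" by (simp flip: mult.assoc power_add)
  finally show ?case .
qed simp

text \<open>Moving \<open>u\<close> through \<open>delta t ^ m\<close> reflects it to
  \<open>u'\<close> and turns the equation into \<open>u * (x * u') = u * delta t ^ m\<close>, where
  \<open>u\<close> cancels. Thus right divisors of a power of the half twist are left divisors
  too.\<close>

lemma ldvd_delta_power_rotate:
  assumes "u * x = delta t ^ m"
  shows "\<exists>u'. x * u' = delta t ^ m"
proof -
  have "supp u \<subseteq> supp (delta t ^ m)" by (metis assms ldvd_supp ldvd_triv)
  also have "\<dots> \<subseteq> {1..t}" by (induction m) auto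
  finally obtain u' where "u * delta t ^ m = delta t ^ m * u'" using ex_flip_power by blast
  then have "u * (x * u') = u * delta t ^ m" by (simp add: assms flip: mult.assoc)
  then show ?thesis by auto
qed

lemma factor_ldvd_delta_power: "u * x * v = delta t ^ m \<Longrightarrow> x ldvd delta t ^ m"
  by (metis ldvd_def ldvd_delta_power_rotate mult.assoc)

lemma supp_ldvd_delta_power: "x ldvd delta t ^ m \<Longrightarrow> supp x \<subseteq> {1..t}"
proof -
  have "supp (delta t ^ m) \<subseteq> {1..t}" by (induction m) auto
  then show "x ldvd delta t ^ m \<Longrightarrow> supp x \<subseteq> {1..t}" using ldvd_supp by blast
qed

text \<open>The complement \<open>A\<close> of \<open>a\<close> is carried across
  \<open>delta t ^ q\<close> by reflection, so exponents add. The exponent bounds for walks and for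
  \<open>Z\<close> come from here.\<close>

lemma mult_ldvd_delta_power:
  assumes "a ldvd delta t ^ p" "b ldvd delta t ^ q"
  shows "a * b ldvd delta t ^ (p + q)"
proof -
  obtain A B where AB: "a * A = delta t ^ p" "b * B = delta t ^ q"
    using assms by (auto simp: ldvd_def)
  have "A ldvd delta t ^ p" using ldvd_delta_power_rotate[OF AB(1)] unfolding ldvd_def by metis
  then obtain A' where "A * delta t ^ q = delta t ^ q * A'"
    using ex_flip_power supp_ldvd_delta_power by blast
  then have "(a * b) * (B * A') = delta t ^ (p + q)"
    by (metis AB mult.assoc power_add)
  then show ?thesis by (metis ldvd_triv)
qed

lemma delta_mono: "s \<le> t \<Longrightarrow> delta s ldvd delta t"
proof (induction t)
  case (Suc t)
  then show ?case by (cases "s = Suc t") (auto intro: ldvd_mult_right)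
qed simp

lemma ldvd_delta_mono: "x ldvd delta s \<Longrightarrow> s \<le> t \<Longrightarrow> x ldvd delta t"
  using delta_mono ldvd_trans by blast

lemma gen_ldvd_delta: "1 \<le> i \<Longrightarrow> i \<le> t \<Longrightarrow> gen i ldvd delta t"
proof -
  assume i: "1 \<le> i" "i \<le> t"
  then obtain s where s: "i = Suc s" by (cases i) auto
  have "delta s * gen i * down s = delta i ^ 1" by (simp add: s down_Suc mult.assoc)
  then have "gen i ldvd delta i" using factor_ldvd_delta_power by (metis power_one_right)
  then show ?thesis using i ldvd_delta_mono by blast
qed

text \<open>For \<open>j \<le> t\<close> these are the first \<open>j\<close> letters of
  \<open>down t\<close>. They are what the top letters contribute when a power of \<open>up\<close>
  is rewritten with one strand fewer.\<close>

primrec descent :: "nat \<Rightarrow> nat \<Rightarrow> pbraid" where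
  "descent t 0 = 1"
| "descent t (Suc j) = descent t j * gen (t - j)"

lemma descent_up: "j \<le> t \<Longrightarrow> descent (Suc t) j * up (Suc t) = up (Suc t) * descent t j"
proof (induction j)
  case (Suc j)
  have "descent (Suc t) (Suc j) * up (Suc t) = descent (Suc t) j * (gen (Suc t - j) * up (Suc t))"
    by (simp add: mult.assoc)
  also have "gen (Suc t - j) * up (Suc t) = up (Suc t) * gen (t - j)"
    using up_gen[of "t - j" "Suc t"] Suc.prems by (simp add: Suc_diff_le)
  finally show ?case using Suc by (simp flip: mult.assoc)
qed simp

lemma gen_descent: "gen (Suc t) * descent t j = descent (Suc t) (Suc j)"
  by (induction j) (simp_all flip: mult.assoc)

lemma descent_full: "descent t t = down t"
proof (induction t)
  case (Suc t)
  then show ?case by (simp only: down_Suc flip: gen_descent)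
qed simp

text \<open>Each new factor \<open>up (Suc t)\<close> passes the descent, lowering its letters by
  one, and leaves its own last letter in front of the lowered descent, which is the longer
  descent.\<close>

lemma up_power: "j \<le> Suc t \<Longrightarrow> up (Suc t) ^ j = up t ^ j * descent (Suc t) j"
proof (induction j)
  case (Suc j)
  have "up (Suc t) ^ Suc j = up t ^ j * (descent (Suc t) j * up (Suc t))"
    using Suc by (simp add: power_Suc2 mult.assoc del: power_Suc)
  also have "\<dots> = up t ^ j * (up t * (gen (Suc t) * descent t j))"
    using Suc.prems by (simp add: descent_up) (simp add: up_Suc mult.assoc)
  also have "\<dots> = up t ^ Suc j * descent (Suc t) (Suc j)"
    by (simp add: gen_descent power_Suc2 mult.assoc del: power_Suc descent.simps)
  finally show ?case .
qed simp

text \<open>At exponent \<open>Suc t\<close> the descent is all of \<open>down (Suc t)\<close>. The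
  remaining \<open>down (Suc t) * up (Suc t)\<close> takes the last strand once around the others,
  so it commutes with \<open>delta t\<close>, and the two factorisations of
  \<open>delta (Suc t)\<close> appear side by side.\<close>

lemma full_twist: "up t ^ Suc t = delta t ^ 2"
proof (induction t)
  case (Suc t)
  let ?D = "down (Suc t)" and ?U = "up (Suc t)"
  have comm: "gen i * (?D * ?U) = ?D * ?U * gen i" if "1 \<le> i" "i \<le> t" for i
    using gen_down[of i "Suc t"] up_gen[of i "Suc t"] that by (metis le_imp_less_Suc mult.assoc)
  have "set w \<subseteq> {1..t} \<Longrightarrow> pword w * (?D * ?U) = ?D * ?U * pword w" for w
  proof (induction w)
    case (Cons i w)
    then show ?case using comm[of i] by (simp add: mult.assoc) (metis mult.assoc)
  qed simp
  then have c: "delta t * (?D * ?U) = ?D * ?U * delta t"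
    using ex_pword[of "delta t"] by (metis order_refl supp_delta supp_pword)
  have "?U ^ Suc (Suc t) = up t ^ Suc t * descent (Suc t) (Suc t) * ?U"
    by (subst power_Suc2) (simp only: up_power[OF order_refl])
  also have "\<dots> = delta t * (delta t * (?D * ?U))"
    by (simp add: Suc descent_full power2_eq_square mult.assoc del: power_Suc descent.simps)
  also have "\<dots> = delta (Suc t) * (?U * delta t)"
    by (simp add: c mult.assoc)
  finally show ?case by (simp add: power2_eq_square flip: delta_Suc_up del: power_Suc)
qed simp

section \<open>Counting the crossings of a pair of strands\<close>

fun strand_swap :: "nat \<Rightarrow> (nat \<Rightarrow> nat) \<Rightarrow> nat \<Rightarrow> nat" where
  "strand_swap i f = f(i := f (Suc i), Suc i := f i)"

primrec strands :: "nat list \<Rightarrow> (nat \<Rightarrow> nat) \<Rightarrow> nat \<Rightarrow> nat" where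
  "strands [] f = f"
| "strands (i # w) f = strands w (strand_swap i f)"

text \<open>\<open>f\<close> labels the strand at each position, and \<open>A\<close> is the pair of labels whose crossings
  are counted.\<close>

primrec crossings :: "nat set \<Rightarrow> nat list \<Rightarrow> (nat \<Rightarrow> nat) \<Rightarrow> nat" where
  "crossings A [] f = 0"
| "crossings A (i # w) f =
    (if A = {f i, f (Suc i)} then 1 else 0) + crossings A w (strand_swap i f)"

lemma strands_append: "strands (u @ v) f = strands v (strands u f)"
  by (induction u arbitrary: f) simp_all

lemma crossings_append: "crossings A (u @ v) f = crossings A u f + crossings A v (strands u f)"
  by (induction u arbitrary: f) simp_all

lemma strands_far: "far i j \<Longrightarrow> strands [i, j] f = strands [j, i] f"
  unfolding far_def by (rule ext) (elim disjE; simp)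

lemma strands_adj: "adj i j \<Longrightarrow> strands [i, j, i] f = strands [j, i, j] f"
  unfolding adj_def by (rule ext) (elim disjE; simp)

lemma crossings_far: "far i j \<Longrightarrow> crossings A [i, j] f = crossings A [j, i] f"
  unfolding far_def by (elim disjE; simp)

lemma crossings_adj: "adj i j \<Longrightarrow> crossings A [i, j, i] f = crossings A [j, i, j] f"
  unfolding adj_def by (elim disjE) (simp_all add: add_ac)

lemma pstep_strands: "pstep v w \<Longrightarrow> strands v f = strands w f \<and> crossings A v f = crossings A w f"
proof (induction rule: pstep.induct)
  case (far i j u v)
  show ?case by (simp only: strands_append crossings_append strands_far[OF far] crossings_far[OF far])
next
  case (adj i j u v)
  show ?case by (simp only: strands_append crossings_append strands_adj[OF adj] crossings_adj[OF adj])
qed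

lemma peq_strands: "peq v w \<Longrightarrow> strands v f = strands w f \<and> crossings A v f = crossings A w f"
  by (induction rule: rtranclp_induct) (simp_all add: pstep_strands)

lift_definition pstrands :: "pbraid \<Rightarrow> (nat \<Rightarrow> nat) \<Rightarrow> nat \<Rightarrow> nat" is strands
  using peq_strands by blast

lift_definition pcrossings :: "nat set \<Rightarrow> pbraid \<Rightarrow> (nat \<Rightarrow> nat) \<Rightarrow> nat" is crossings
  using peq_strands by blast

lemma pstrands_one [simp]: "pstrands 1 f = f" by transfer simp
lemma pstrands_mult [simp]: "pstrands (x * y) f = pstrands y (pstrands x f)"
  by transfer (rule strands_append)
lemma pstrands_gen [simp]: "pstrands (gen i) f = strand_swap i f"
  unfolding gen_def by transfer simp
lemma pcrossings_one [simp]: "pcrossings A 1 f = 0" by transfer simp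
lemma pcrossings_mult [simp]:
  "pcrossings A (x * y) f = pcrossings A x f + pcrossings A y (pstrands x f)"
  by transfer (rule crossings_append)
lemma pcrossings_gen [simp]: "pcrossings A (gen i) f = (if A = {f i, f (Suc i)} then 1 else 0)"
  unfolding gen_def by transfer simp

lemma inj_strand_swap: "inj f \<Longrightarrow> inj (strand_swap i f)"
proof (rule injI)
  fix x y assume "inj f" "strand_swap i f x = strand_swap i f y"
  then show "x = y" by (simp add: inj_eq split: if_splits)
qed

lemma inj_pstrands: "inj f \<Longrightarrow> inj (pstrands x f)"
proof -
  have "inj f \<Longrightarrow> inj (pstrands (pword w) f)" for w
    by (induction w arbitrary: f) (auto simp: inj_strand_swap simp del: strand_swap.simps)
  then show "inj f \<Longrightarrow> inj (pstrands x f)" using ex_pword by metis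
qed

lemma pstrands_fixed: "supp x \<subseteq> {1..t} \<Longrightarrow> Suc t < j \<Longrightarrow> pstrands x f j = f j"
proof -
  have "set w \<subseteq> {1..t} \<Longrightarrow> Suc t < j \<Longrightarrow> pstrands (pword w) f j = f j" for w
    by (induction w arbitrary: f) auto
  then show "supp x \<subseteq> {1..t} \<Longrightarrow> Suc t < j \<Longrightarrow> pstrands x f j = f j"
    using ex_pword by (metis supp_pword)
qed

lemma pstrands_image: "supp x \<subseteq> {1..t} \<Longrightarrow> pstrands x f ` {1..Suc t} = f ` {1..Suc t}"
proof -
  have *: "strand_swap i f ` {1..Suc t} = f ` {1..Suc t}" if "1 \<le> i" "i \<le> t" for i f
  proof -
    have "f k \<in> strand_swap i f ` {1..Suc t}" if "k \<in> {1..Suc t}" for k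
      using that \<open>1 \<le> i\<close> \<open>i \<le> t\<close>
      by (intro image_eqI[of _ _ "if k = i then Suc i else if k = Suc i then i else k"]) auto
    then show ?thesis using that by auto
  qed
  have "set w \<subseteq> {1..t} \<Longrightarrow> pstrands (pword w) f ` {1..Suc t} = f ` {1..Suc t}" for w
  proof (induction w arbitrary: f)
    case (Cons i w)
    then show ?case using *[of i f] by (simp del: strand_swap.simps)
  qed simp
  then show "supp x \<subseteq> {1..t} \<Longrightarrow> pstrands x f ` {1..Suc t} = f ` {1..Suc t}"
    using ex_pword by (metis supp_pword)
qed

text \<open>The strand at position \<open>Suc t\<close> travels to position 1 and meets each of the
  other \<open>t\<close> strands once; injectivity of the labels keeps these pairs distinct.\<close>

lemma pcrossings_down:
  "inj f \<Longrightarrow> pcrossings A (down t) f \<le> 1 \<and>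
    (pcrossings A (down t) f \<noteq> 0 \<longrightarrow> (\<exists>j\<in>{1..t}. A = {f (Suc t), f j}))"
proof (induction t arbitrary: f)
  case (Suc t)
  let ?g = "strand_swap (Suc t) f"
  have IH: "pcrossings A (down t) ?g \<le> 1"
    "pcrossings A (down t) ?g \<noteq> 0 \<longrightarrow> (\<exists>j\<in>{1..t}. A = {f (Suc (Suc t)), f j})"
    using Suc.IH[OF inj_strand_swap[OF Suc.prems, of "Suc t"]] by fastforce+
  have "pcrossings A (down t) ?g = 0" if "A = {f (Suc t), f (Suc (Suc t))}"
  proof (rule ccontr)
    assume "pcrossings A (down t) ?g \<noteq> 0"
    then obtain j where "j \<in> {1..t}" "{f (Suc t), f (Suc (Suc t))} = {f (Suc (Suc t)), f j}"
      using IH(2) \<open>A = _\<close> by auto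
    then show False using Suc.prems by (auto simp: doubleton_eq_iff inj_eq)
  qed
  moreover have "\<exists>j\<in>{1..Suc t}. A = {f (Suc (Suc t)), f j}"
    if "A = {f (Suc t), f (Suc (Suc t))}"
    using that by (intro bexI[of _ "Suc t"]) auto
  ultimately show ?case using IH by (auto simp: down_Suc simp del: strand_swap.simps)
qed simp

text \<open>In the induction step a pair of old strands crosses only in \<open>delta t\<close>, and
  a pair containing the new strand only in \<open>down (Suc t)\<close>; so no pair crosses
  twice.\<close>

lemma pcrossings_delta:
  "inj f \<Longrightarrow> pcrossings A (delta t) f \<le> 1 \<and> (pcrossings A (delta t) f \<noteq> 0 \<longrightarrow> A \<subseteq> f ` {1..Suc t})"
proof (induction t)
  case (Suc t)
  let ?g = "pstrands (delta t) f"
  have g: "inj ?g" "?g (Suc (Suc t)) = f (Suc (Suc t))" "?g ` {1..Suc t} = f ` {1..Suc t}"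
    using inj_pstrands[OF Suc.prems] pstrands_fixed[of "delta t" t] pstrands_image[of "delta t" t]
    by simp_all
  have D: "pcrossings A (down (Suc t)) ?g \<le> 1"
    "pcrossings A (down (Suc t)) ?g \<noteq> 0 \<Longrightarrow> \<exists>j\<in>{1..Suc t}. A = {f (Suc (Suc t)), ?g j}"
    using pcrossings_down[OF g(1), of A "Suc t"] g(2) by auto
  have new: "f (Suc (Suc t)) \<in> A \<and> A \<subseteq> f ` {1..Suc (Suc t)}"
    if nz: "pcrossings A (down (Suc t)) ?g \<noteq> 0"
  proof -
    obtain j where "j \<in> {1..Suc t}" "A = {f (Suc (Suc t)), ?g j}" using D(2)[OF nz] by blast
    moreover have "?g j \<in> f ` {1..Suc t}" using g(3) calculation(1) by blast
    ultimately show ?thesis by auto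
  qed
  have "f (Suc (Suc t)) \<notin> f ` {1..Suc t}" using Suc.prems by (auto simp: inj_eq)
  then have "pcrossings A (delta t) f = 0 \<or> pcrossings A (down (Suc t)) ?g = 0"
    using Suc new by blast
  then show ?case using Suc new D by fastforce
qed simp

text \<open>The letters of \<open>gen j ^ r\<close> all cross the same two strands, whereas a half
  twist crosses them at most once. This bounds from below the power of the half twist that can
  absorb \<open>gen T ^ r\<close>.\<close>

lemma gen_power_ldvd_delta_power:
  assumes "gen j ^ r ldvd delta t ^ m"
  shows "r \<le> m"
proof -
  obtain y where y: "delta t ^ m = gen j ^ r * y" using assms by (auto simp: ldvd_def)
  \<comment> \<open>The labels at \<open>j\<close> and \<open>Suc j\<close> alternate, but the
    unordered pair \<open>A\<close> stays the same.\<close>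
  have 1: "{f j, f (Suc j)} = A \<Longrightarrow> pcrossings A (gen j ^ r) f = r" for f A
  proof (induction r arbitrary: f)
    case (Suc r)
    have "pcrossings A (gen j ^ r) (strand_swap j f) = r"
      by (rule Suc.IH) (use Suc.prems in \<open>simp add: insert_commute\<close>)
    then show ?case using Suc.prems by (simp del: strand_swap.simps)
  qed simp
  have 2: "inj f \<Longrightarrow> pcrossings A (delta t ^ m) f \<le> m" for f A
  proof (induction m arbitrary: f)
    case (Suc m)
    have "pcrossings A (delta t ^ m) (pstrands (delta t) f) \<le> m"
      by (rule Suc.IH) (rule inj_pstrands[OF Suc.prems])
    then show ?case using pcrossings_delta[OF Suc.prems, of A t] by simp
  qed simp
  have "r \<le> pcrossings {j, Suc j} (delta t ^ m) id" using 1[of id "{j, Suc j}"] by (simp add: y)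
  also have "\<dots> \<le> m" by (rule 2) simp
  finally show ?thesis .
qed

text \<open>Used to show that divisors of the half twist are maximal: one that ends in a letter
  cannot be prolonged by the same letter.\<close>

lemma gen_sq_not_factor: "u * (gen j * (gen j * v)) \<noteq> delta t"
proof
  assume "u * (gen j * (gen j * v)) = delta t"
  then have "u * (gen j ^ 2) * v = delta t ^ 1" by (simp add: power2_eq_square mult.assoc)
  then have "gen j ^ 2 ldvd delta t ^ 1" by (rule factor_ldvd_delta_power)
  then show False using gen_power_ldvd_delta_power[of j 2 t 1] by simp
qed

section \<open>Conjugates of Coxeter elements\<close>

text \<open>Exactly the words to which no braid relation applies: neighbours are equal or adjacent
  letters, and no pattern \<open>i, j, i\<close> with \<open>i \<noteq> j\<close> occurs. Such a
  word is the only one that represents its braid.\<close>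

fun rigid :: "nat list \<Rightarrow> bool" where
  "rigid (x # y # w) \<longleftrightarrow> \<not> far x y \<and> (x \<noteq> y \<longrightarrow> w = [] \<or> hd w \<noteq> x) \<and> rigid (y # w)"
| "rigid w \<longleftrightarrow> True"

lemma not_gen_ldvd_one [simp]: "\<not> gen j ldvd 1"
  using ldvd_plen[of "gen j" 1] by auto

lemma rigid_Cons: "rigid (x # w) \<Longrightarrow> rigid w"
  by (cases w) auto

text \<open>For \<open>j \<noteq> x\<close> the induction identifies the second letter with
  \<open>j\<close>. If \<open>j\<close> is far from \<open>x\<close>, this contradicts rigidity; if
  it is adjacent, the third letter must be \<open>x\<close>, and \<open>x, j, x\<close> is the
  excluded pattern.\<close>

lemma rigid_gen_ldvd:
  "rigid (x # w) \<Longrightarrow> gen j ldvd pword (x # w) \<Longrightarrow> j = x"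
proof (induction w arbitrary: x j rule: length_induct)
  case (1 w)
  have dvd: "gen j ldvd gen x * pword w" using "1.prems"(2) by simp
  show ?case
  proof (cases w)
    case Nil
    show ?thesis
    proof (cases x j rule: letter_cases)
      case 2
      then show ?thesis using gen_ldvd_far[OF 2 dvd] Nil by simp
    next
      case 3
      then show ?thesis using mult_ldvd_left[OF gen_ldvd_adj[OF 3 dvd]] Nil by simp
    qed simp
  next
    case (Cons y v)
    have y: "gen i ldvd pword (y # v) \<Longrightarrow> i = y" for i
      by (rule "1.IH"[rule_format, of v]) (use Cons "1.prems"(1) in simp_all)
    show ?thesis
    proof (cases x j rule: letter_cases)
      case 2
      then have "gen j ldvd pword w" using dvd gen_ldvd_far by blast
      then have "j = y" using y Cons by simp
      then show ?thesis using "1.prems"(1) Cons 2 by simp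
    next
      case 3
      then have *: "gen j * gen x ldvd gen y * pword v" using gen_ldvd_adj[OF 3 dvd] Cons by simp
      then have jy: "j = y" using y mult_ldvd_left by auto
      then have xv: "gen x ldvd pword v" using * by simp
      have "x \<noteq> y" using 3 jy by (auto simp: adj_def)
      then show ?thesis
      proof (cases v)
        case Nil
        then show ?thesis using xv by simp
      next
        case (Cons z v')
        have "rigid (z # v')" using "1.prems"(1) \<open>w = y # v\<close> Cons rigid_Cons by blast
        then have "x = z" using "1.IH"[rule_format, of v' z x] xv \<open>w = y # v\<close> Cons by simp
        then show ?thesis using "1.prems"(1) \<open>w = y # v\<close> Cons \<open>x \<noteq> y\<close> by simp
      qed
    qed simp
  qed
qed

lemma rigid_pword_inject:
  "rigid u \<Longrightarrow> rigid w \<Longrightarrow> pword u = pword w \<Longrightarrow> u = w"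
proof (induction u arbitrary: w)
  case Nil
  then show ?case using plen_pword[of w] plen_pword[of "[]"] by simp
next
  case (Cons x u)
  then obtain y v where w: "w = y # v"
    using plen_pword[of w] plen_pword[of "x # u"] by (cases w) auto
  have "gen x ldvd pword w" using Cons.prems(3)[symmetric] by simp
  then have "x = y" using rigid_gen_ldvd Cons.prems(2) w by blast
  then show ?case using Cons w rigid_Cons by auto
qed

section \<open>Chains and walks\<close>

function chain :: "nat \<Rightarrow> nat \<Rightarrow> nat list" where
  "chain l m = (if l = m then [l] else l # chain (if l < m then Suc l else l - 1) m)"
  by auto
termination by (relation "measure (\<lambda>(l, m). (l - m) + (m - l))") auto

declare chain.simps [simp del]

lemma chain_same [simp]: "chain l l = [l]"
  and chain_less: "l < m \<Longrightarrow> chain l m = l # chain (Suc l) m"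
  and chain_greater: "m < l \<Longrightarrow> chain l m = l # chain (l - 1) m"
  by (subst chain.simps; simp)+

lemma chain_induct [case_names same less greater]:
  assumes "\<And>m. P m m" "\<And>l m. l < m \<Longrightarrow> P (Suc l) m \<Longrightarrow> P l m"
    "\<And>l m. m < l \<Longrightarrow> P (l - 1) m \<Longrightarrow> P l m"
  shows "P l m"
proof (induction l m rule: chain.induct)
  case (1 l m)
  then show ?case using assms by (cases l m rule: linorder_cases) auto
qed

lemma hd_chain [simp]: "hd (chain l m) = l" "chain l m \<noteq> []"
  by (subst chain.simps, simp)+

text \<open>A chain is monotone, so inside it no letter returns. At the junction the letter
  \<open>m\<close> is doubled, which rigidity permits; a change of direction without the repetition
  would produce \<open>i, j, i\<close>.\<close>

lemma rigid_chain:
  "r = [] \<or> rigid r \<and> hd r = m \<Longrightarrow> rigid (chain l m @ r)"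
proof (induction l m rule: chain_induct)
  case (same m)
  then show ?case by (cases r) (auto simp: far_def)
next
  case (less l m)
  then have IH: "rigid (chain (Suc l) m @ r)" by simp
  show ?case
  proof (cases "Suc l = m")
    case True
    then show ?thesis using IH less by (auto simp: chain_less far_def)
  next
    case False
    then have m: "Suc l < m" using less by simp
    show ?thesis using IH less(1) by (auto simp: chain_less[OF less(1)] chain_less[OF m] far_def)
  qed
next
  case (greater l m)
  then obtain p where p: "l = Suc p" by (cases l) auto
  have IH: "rigid (chain p m @ r)" using greater p by simp
  show ?case
  proof (cases "p = m")
    case True
    then show ?thesis using IH greater by (auto simp: p chain_greater far_def)
  next
    case False
    then have m: "m < p" using greater(1) p by simp
    show ?thesis using IH m by (auto simp: p chain_greater far_def)
  qed
qed

primrec walk :: "nat \<Rightarrow> nat list \<Rightarrow> nat list" where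
  "walk l [] = []"
| "walk l (m # ls) = chain l m @ walk m ls"

lemma walk_hd: "ls \<noteq> [] \<Longrightarrow> walk l ls \<noteq> [] \<and> hd (walk l ls) = l"
  by (cases ls) auto

lemma rigid_walk: "rigid (walk l ls)"
proof (induction ls arbitrary: l)
  case (Cons m ls)
  show ?case using rigid_chain[of "walk m ls" m l] Cons walk_hd[of ls m] by (cases ls) auto
qed simp

text \<open>Reads the end of the first chain off a walk: neighbours within a chain differ, so the
  first doubled letter marks the junction, and if there is none, the last letter is the end.\<close>

fun turn :: "nat list \<Rightarrow> nat" where
  "turn (x # y # w) = (if x = y then x else turn (y # w))"
| "turn [x] = x"
| "turn [] = 0"

lemma turn_Cons_chain: "x \<noteq> l \<Longrightarrow> turn (x # chain l m @ r) = turn (chain l m @ r)"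
  using hd_chain[of l m] by (cases "chain l m") auto

lemma turn_chain: "r = [] \<or> hd r = m \<Longrightarrow> turn (chain l m @ r) = m"
proof (induction l m rule: chain_induct)
  case (same m)
  then show ?case by (cases r) auto
next
  case (less l m)
  then show ?case by (simp add: chain_less[OF less(1)] turn_Cons_chain)
next
  case (greater l m)
  then show ?case by (simp add: chain_greater[OF greater(1)] turn_Cons_chain)
qed

lemma walk_inject: "length ls = length ls' \<Longrightarrow> walk l ls = walk l ls' \<Longrightarrow> ls = ls'"
proof (induction ls ls' arbitrary: l rule: list_induct2)
  case (Cons m ls m' ls')
  have "turn (walk l (m # ls)) = m" for m ls
    using turn_chain[of "walk m ls" m l] walk_hd[of ls m] by (cases "ls = []") simp_all
  then have "m = m'" using Cons.prems by metis
  then show ?case using Cons by simp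
qed simp

lemma chain_up: "l \<le> m \<Longrightarrow> chain l m = [l..<Suc m]"
proof (induction l m rule: chain_induct)
  case (less l m)
  then show ?case using upt_conv_Cons[of l "Suc m"] by (simp add: chain_less[OF less(1)] del: upt_Suc)
qed simp_all

lemma chain_down: "m \<le> l \<Longrightarrow> chain l m = rev [m..<Suc l]"
proof (induction l m rule: chain_induct)
  case (greater l m)
  then obtain p where "l = Suc p" by (cases l) auto
  then show ?case using greater chain_greater[of m "Suc p"] by simp
qed simp_all

lemma upt_split: "i \<le> j \<Longrightarrow> j \<le> k \<Longrightarrow> [i..<k] = [i..<j] @ [j..<k]"
  using upt_add_eq_append[of i j "k - j"] by simp

text \<open>An ascending chain is a factor of \<open>up t\<close>, a descending one of
  \<open>down t\<close>; both occur in factorisations of \<open>delta t\<close>, and even an inner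
  factor of the half twist is a left divisor.\<close>

lemma chain_ldvd_delta:
  assumes "l \<in> {1..t}" "m \<in> {1..t}"
  shows "pword (chain l m) ldvd delta t"
proof -
  obtain s where s: "t = Suc s" using assms by (cases t) auto
  show ?thesis
  proof (cases "l \<le> m")
    case True
    have "[1..<Suc t] = [1..<l] @ [l..<Suc m] @ [Suc m..<Suc t]"
      using assms True upt_split[of 1 l "Suc t"] upt_split[of l "Suc m" "Suc t"]
      by (simp del: upt_Suc)
    then have "up t = pword [1..<l] * (pword (chain l m) * pword [Suc m..<Suc t])"
      unfolding up_def chain_up[OF True] by (simp only: pword_append)
    then have "pword [1..<l] * pword (chain l m) * (pword [Suc m..<Suc t] * delta s) = delta t ^ 1"
      by (simp only: s delta_Suc_up power_one_right mult.assoc)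
    then show ?thesis using factor_ldvd_delta_power by (metis power_one_right)
  next
    case False
    then have ml: "m \<le> l" by simp
    have "[1..<Suc t] = [1..<m] @ [m..<Suc l] @ [Suc l..<Suc t]"
      using assms ml upt_split[of 1 m "Suc t"] upt_split[of m "Suc l" "Suc t"]
      by (simp del: upt_Suc)
    then have "down t = pword (rev [Suc l..<Suc t]) * (pword (chain l m) * pword (rev [1..<m]))"
      unfolding down_def chain_down[OF ml] by (simp only: pword_append rev_append mult.assoc)
    then have "(delta s * pword (rev [Suc l..<Suc t])) * pword (chain l m) * pword (rev [1..<m])
        = delta t ^ 1"
      by (simp only: s delta.simps power_one_right mult.assoc)
    then show ?thesis using factor_ldvd_delta_power by (metis power_one_right)
  qed
qed

lemma walk_ldvd_delta_power:
  "l \<in> {1..t} \<Longrightarrow> set ls \<subseteq> {1..t} \<Longrightarrow> pword (walk l ls) ldvd delta t ^ length ls"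
proof (induction ls arbitrary: l)
  case (Cons m ls)
  have "pword (chain l m) ldvd delta t ^ 1" using chain_ldvd_delta Cons.prems by simp
  moreover have "pword (walk m ls) ldvd delta t ^ length ls" using Cons by simp
  ultimately show ?case using mult_ldvd_delta_power[of _ t 1] by simp
qed simp

text \<open>Coxeter elements on the generators 1 to \<open>length bs + 1\<close>: each bit puts the
  next generator to the right or to the left of all smaller ones, and the head of the list decides
  for the largest. Lists of length \<open>n - 2\<close> give the factor
  \<open>2 ^ (n - 2)\<close>.\<close>

primrec coxeter :: "bool list \<Rightarrow> pbraid" where
  "coxeter [] = gen 1"
| "coxeter (b # bs) = (if b then coxeter bs * gen (length bs + 2) else gen (length bs + 2) * coxeter bs)"

lemma supp_coxeter: "supp (coxeter bs) = {1..length bs + 1}"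
  by (induction bs) auto

lemma ldvd_delta_power_right: "x ldvd delta t ^ m \<Longrightarrow> \<exists>u. u * x = delta t ^ m"
proof -
  assume x: "x ldvd delta t ^ m"
  then obtain v where v: "x * v = delta t ^ m" by (auto simp: ldvd_def)
  have "v ldvd delta t ^ m" using ldvd_delta_power_rotate[OF v] unfolding ldvd_def by metis
  then obtain v' where "delta t ^ m * v = v' * delta t ^ m"
    using supp_ldvd_delta_power ex_flip_power by blast
  then have "v' * x * v = delta t ^ m * v" by (simp add: v mult.assoc)
  then show ?thesis by auto
qed

text \<open>A generator added on the right is continued by \<open>down\<close>, one added on the
  left is preceded by \<open>up\<close>; so each choice of side uses its own factorisation of the
  larger half twist.\<close>

lemma coxeter_ldvd_delta: "coxeter bs ldvd delta (length bs + 1)"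
proof (induction bs)
  case Nil
  then show ?case using gen_ldvd_delta[of 1 1] by (simp del: delta.simps)
next
  case (Cons b bs)
  let ?s = "length bs + 1"
  obtain v where v: "coxeter bs * v = delta ?s" using Cons by (auto simp: ldvd_def)
  obtain u where u: "u * coxeter bs = delta ?s"
    using ldvd_delta_power_right[of "coxeter bs" ?s 1] Cons by auto
  have "u * (coxeter bs * gen (Suc ?s)) * down ?s = delta (Suc ?s) ^ 1"
    using u by (simp add: down_Suc mult.assoc) (metis mult.assoc)
  moreover have "up ?s * (gen (Suc ?s) * coxeter bs) * v = delta (Suc ?s) ^ 1"
    unfolding delta_Suc_up using v by (simp add: up_Suc mult.assoc)
  ultimately have "coxeter bs * gen (Suc ?s) ldvd delta (Suc ?s) ^ 1"
      "gen (Suc ?s) * coxeter bs ldvd delta (Suc ?s) ^ 1"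
    using factor_ldvd_delta_power by blast+
  then show ?case by (simp del: delta.simps)
qed

text \<open>Put \<open>j = length bs + 2\<close>. Among the letters of \<open>coxeter bs\<close>
  only \<open>j - 1\<close> is adjacent to \<open>j\<close>; the others are skipped. Passing
  \<open>gen (j - 1)\<close> requires the divisor \<open>gen j * gen (j - 1)\<close>, whose first
  letter cancels against the \<open>gen j\<close> in front of \<open>a\<close>.\<close>

lemma gen_ldvd_coxeter_gen:
  assumes "gen (length bs + 2) ldvd coxeter bs * (gen (length bs + 2) * a)"
  shows "gen (length bs + 1) ldvd a"
proof (cases bs)
  case Nil
  have "adj 1 2" by (simp add: adj_def)
  then show ?thesis using gen_ldvd_adj[of 1 2 "gen 2 * a"] assms Nil by (simp add: numeral_2_eq_2)
next
  case (Cons b bs')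
  let ?T = "length bs + 2" and ?S = "length bs + 1"
  have adj: "adj ?S ?T" by (simp add: adj_def)
  have skip: "?T \<notin> supp (coxeter bs')" "?S \<notin> supp (coxeter bs')"
    using Cons by (auto simp: supp_coxeter)
  have S: "?S = length bs' + 2" using Cons by simp
  show ?thesis
  proof (cases b)
    case True
    have "gen ?T ldvd coxeter bs' * (gen ?S * (gen ?T * a))"
      using assms Cons True by (simp add: mult.assoc)
    then have "gen ?T ldvd gen ?S * (gen ?T * a)" using gen_ldvd_skip skip(1) by blast
    from gen_ldvd_adj[OF adj this] show ?thesis by simp
  next
    case False
    have "gen ?T * coxeter bs' = coxeter bs' * gen ?T"
      by (rule supp_far_commute) (use Cons in \<open>auto simp: supp_coxeter far_def\<close>)
    then have *: "coxeter bs' * (gen ?T * a) = gen ?T * (coxeter bs' * a)"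
      by (metis mult.assoc)
    have "gen ?T ldvd gen ?S * (coxeter bs' * (gen ?T * a))"
      using assms Cons False by (simp add: mult.assoc)
    then have "gen ?T * gen ?S ldvd gen ?T * (coxeter bs' * a)"
      using gen_ldvd_adj[OF adj] unfolding * by blast
    then have "gen ?S ldvd coxeter bs' * a" by simp
    then show ?thesis using gen_ldvd_skip skip(2) by blast
  qed
qed

text \<open>The side of the top generator is visible: if it stood on the right in one element and on
  the left in the other, \<open>gen_ldvd_coxeter_gen\<close> with \<open>a = 1\<close> would make a
  generator divide 1.\<close>

lemma coxeter_inject: "length bs = length bs' \<Longrightarrow> coxeter bs = coxeter bs' \<Longrightarrow> bs = bs'"
proof (induction bs bs' rule: list_induct2)
  case (Cons b bs b' bs')
  have *: False if "coxeter cs * gen (length cs + 2) = gen (length cs + 2) * c" for cs c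
    using gen_ldvd_coxeter_gen[of cs 1] that by simp
  have "coxeter bs * gen (length bs + 2) \<noteq> gen (length bs + 2) * coxeter bs'"
    "coxeter bs' * gen (length bs + 2) \<noteq> gen (length bs + 2) * coxeter bs"
    using *[of bs] *[of bs'] Cons.hyps by metis+
  then show ?case using Cons.prems Cons.hyps Cons.IH by (cases b; cases b') auto
qed simp

text \<open>Chosen so that this letter, as the only first letter of \<open>a\<close>, does not
  left-divide \<open>coxeter bs * a\<close>. With the top generator on the right, the top letter
  qualifies, since \<open>gen_ldvd_coxeter_gen\<close> would demand another first letter of
  \<open>a\<close>. With the top generator on the left, the top letter does divide the product, so
  the letter below it is taken.\<close>

fun walk_start :: "bool list \<Rightarrow> nat" where
  "walk_start (True # bs) = length bs + 2"
| "walk_start (False # bs) = length bs + 1"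
| "walk_start [] = 1"

text \<open>A nontrivial \<open>d\<close> begins with a letter dividing \<open>a\<close>, hence with
  \<open>walk_start bs\<close>; it remains to refute that this letter divides
  \<open>coxeter bs * a\<close>. With the top generator on the left, the refutation also depends on
  the side of the next lower generator.\<close>

lemma coxeter_coprime:
  assumes bs: "bs \<noteq> []" and a: "\<And>j. gen j ldvd a \<Longrightarrow> j = walk_start bs"
    and d: "d ldvd a" "d ldvd coxeter bs * a"
  shows "d = 1"
proof (cases d rule: pbraid_cases)
  case (2 j d')
  let ?l = "walk_start bs"
  have "gen j ldvd d" using 2 by simp
  then have j: "gen j ldvd a" "gen j ldvd coxeter bs * a" using d ldvd_trans by blast+
  then have l: "gen ?l ldvd coxeter bs * a" using a by blast
  obtain b cs where b: "bs = b # cs" using bs by (cases bs) auto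
  show ?thesis
  proof (cases b)
    case True
    then have "gen (length cs + 1) ldvd a"
      using l b gen_ldvd_coxeter_gen by (simp add: mult.assoc)
    then show ?thesis using a b True by fastforce
  next
    case False
    let ?T = "length cs + 2" and ?S = "length cs + 1"
    have adj: "adj ?T ?S" by (simp add: adj_def)
    have "gen ?S ldvd gen ?T * (coxeter cs * a)" using l b False by (simp add: mult.assoc)
    then have st: "gen ?S * gen ?T ldvd coxeter cs * a" using gen_ldvd_adj[OF adj] by blast
    have noT: "\<not> gen ?T ldvd a" using a[of ?T] b False by auto
    show ?thesis
    proof (cases cs)
      case Nil
      then show ?thesis using st noT by simp
    next
      case (Cons c es)
      show ?thesis
      proof (cases c)
        case True
        then have "gen ?S ldvd coxeter es * (gen ?S * a)"
          using mult_ldvd_left[OF st] Cons by (simp add: mult.assoc)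
        then have "gen (length es + 1) ldvd a"
          using gen_ldvd_coxeter_gen[of es a] Cons by simp
        then show ?thesis using a b False Cons by fastforce
      next
        case False
        then have "gen ?T ldvd coxeter es * a"
          using st Cons by (simp add: mult.assoc)
        moreover have "?T \<notin> supp (coxeter es)" by (auto simp: supp_coxeter Cons)
        ultimately show ?thesis using noT gen_ldvd_skip by blast
      qed
    qed
  qed
qed

text \<open>Conjugating by \<open>coxeter bs\<close>, which commutes with \<open>U\<close> and \<open>V\<close>, moves the generator to the
  left of it over to its right.\<close>

lemma coxeter_conjugate_up_context:
  assumes "supp U \<subseteq> {length bs + 2..M}" "supp V \<subseteq> {length bs + 2..M}" "length bs + 1 \<le> M"
  shows "\<exists>x. supp x \<subseteq> {1..M} \<and>
    x * (U * coxeter bs * V) = U * up (length bs + 1) * V * x"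
  using assms
proof (induction bs arbitrary: U V)
  case Nil
  have "gen 1 = up 1" by (simp add: up_def)
  then show ?case by (intro exI[of _ 1]) simp
next
  case (Cons b bs)
  let ?T = "length bs + 2"
  have up: "up (length (b # bs) + 1) = up (length bs + 1) * gen ?T" by (simp add: up_Suc)
  have "\<exists>y. supp y \<subseteq> {1..M} \<and> y * (U * coxeter bs * (gen ?T * V))
      = U * up (length bs + 1) * (gen ?T * V) * y"
    by (rule Cons.IH) (use Cons.prems in auto)
  then obtain y where y: "supp y \<subseteq> {1..M}"
    "y * (U * coxeter bs * (gen ?T * V)) = U * up (length (b # bs) + 1) * V * y"
    unfolding up by (auto simp: mult.assoc)
  show ?case
  proof (cases b)
    case True
    then show ?thesis using y by (auto simp: mult.assoc)
  next
    case False
    let ?D = "coxeter bs"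
    have "U * ?D = ?D * U" "V * ?D = ?D * V"
      by (rule supp_far_commute, use Cons.prems in \<open>force simp: supp_coxeter far_def\<close>)+
    then have "?D * (U * (gen ?T * ?D) * V) = U * ?D * (gen ?T * V) * ?D"
      by (metis mult.assoc)
    then have "y * ?D * (U * coxeter (b # bs) * V) = U * up (length (b # bs) + 1) * V * (y * ?D)"
      using False y(2) by (simp add: mult.assoc) (metis mult.assoc)
    moreover have "supp (y * ?D) \<subseteq> {1..M}" using y(1) Cons.prems by (auto simp: supp_coxeter)
    ultimately show ?thesis by blast
  qed
qed

lemma coxeter_conjugate_up:
  "\<exists>x. supp x \<subseteq> {1..length bs + 1} \<and> x * coxeter bs = up (length bs + 1) * x"
  using coxeter_conjugate_up_context[of 1 bs "length bs + 1" 1] by simp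

text \<open>With \<open>a * a' = delta t ^ m\<close> take \<open>a' * delta t * C * a\<close>:
  reflecting \<open>a'\<close> brings the spare half twist to the front, and the four factors divide
  the powers m, 1, 1 and m.\<close>

lemma ex_conjugate:
  assumes "a ldvd delta t ^ m" "C ldvd delta t"
  shows "\<exists>Z. a * Z = delta t ^ Suc m * C * a \<and> delta t ldvd Z \<and> Z ldvd delta t ^ (2 * Suc m)"
proof -
  obtain a' where a': "a * a' = delta t ^ m" using assms(1) by (auto simp: ldvd_def)
  have dvd: "a' ldvd delta t ^ m" using ldvd_delta_power_rotate[OF a'] unfolding ldvd_def by metis
  let ?Z = "a' * (delta t * (C * a))"
  have "a * ?Z = delta t ^ Suc m * C * a"
    by (simp add: power_Suc2 mult.assoc flip: a' del: power_Suc)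
  moreover have "delta t ldvd ?Z"
    using ex_flip[OF supp_ldvd_delta_power[OF dvd]]
    by (metis ldvd_triv mult.assoc)
  moreover have "?Z ldvd delta t ^ (m + (1 + (1 + m)))"
    using assms dvd by (intro mult_ldvd_delta_power) simp_all
  ultimately show ?thesis by (intro exI[of _ ?Z]) (simp add: mult_2)
qed

text \<open>A fraction \<open>a\<inverse> b\<close> in lowest terms determines \<open>a\<close> and \<open>b\<close>; here \<open>b = C a\<close>.\<close>

lemma conjugate_inject:
  assumes a: "a ldvd delta t ^ m" and a': "a' ldvd delta t ^ m"
    and C: "supp C \<subseteq> {1..t}" and C': "supp C' \<subseteq> {1..t}"
    and Z: "a * Z = delta t ^ (2 * k) * C * a" and Z': "a' * Z = delta t ^ (2 * k) * C' * a'"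
    and cop: "\<And>d. d ldvd a \<Longrightarrow> d ldvd C * a \<Longrightarrow> d = 1"
    and cop': "\<And>d. d ldvd a' \<Longrightarrow> d ldvd C' * a' \<Longrightarrow> d = 1"
  shows "a = a' \<and> C = C'"
proof -
  \<comment> \<open>The complements \<open>u\<close> and \<open>u'\<close> bring both fractions to
    the common denominator \<open>delta t ^ m\<close>; coprimality makes each complement the gcd of
    the same two braids.\<close>
  obtain u u' where u: "u * a = delta t ^ m" and u': "u' * a' = delta t ^ m"
    using ldvd_delta_power_right a a' by metis
  have su: "supp u \<subseteq> {1..t}" "supp u' \<subseteq> {1..t}"
    using u u' by (metis ldvd_triv supp_ldvd_delta_power)+
  have "u * (a * Z) = delta t ^ (2 * k) * (u * (C * a))"
    unfolding Z by (metis delta_sq_central[OF su(1)] mult.assoc)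
  moreover have "u' * (a' * Z) = delta t ^ (2 * k) * (u' * (C' * a'))"
    unfolding Z' by (metis delta_sq_central[OF su(2)] mult.assoc)
  moreover have "u * (a * Z) = u' * (a' * Z)" by (metis mult.assoc u u')
  ultimately have eq: "u * (C * a) = u' * (C' * a')" by simp
  have ua: "u * a = u' * a'" using u u' by simp
  have gcd: "v ldvd u" if v: "v ldvd u * a" "v ldvd u * (C * a)"
      and cop: "\<And>d. d ldvd a \<Longrightarrow> d ldvd C * a \<Longrightarrow> d = 1" for u a C v
  proof -
    obtain d where d: "d ldvd u * a" "d ldvd u * (C * a)"
      "\<And>w. w ldvd u * a \<Longrightarrow> w ldvd u * (C * a) \<Longrightarrow> w ldvd d"
      using ex_gcd by metis
    obtain h where h: "d = u * h" using d(3)[of u] by (auto simp: ldvd_def)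
    then have "h = 1" using d(1,2) cop by simp
    then show ?thesis using d(3) v h by simp
  qed
  have "u' ldvd u" by (rule gcd[of u' u a C]) (simp add: ua, simp add: eq, rule cop)
  moreover have "u ldvd u'"
    by (rule gcd[of u u' a' C']) (simp flip: ua, simp flip: eq, rule cop')
  ultimately have "u = u'" by (rule ldvd_antisym[rotated])
  then have "a = a'" using ua by simp
  then show ?thesis using eq \<open>u = u'\<close> by simp
qed

section \<open>The braid group\<close>

definition pos_word :: "nat list \<Rightarrow> braid_word" where
  "pos_word w = map (\<lambda>i. (i, True)) w"

lemma pos_word_append [simp]: "pos_word (u @ v) = pos_word u @ pos_word v"
  by (simp add: pos_word_def)

lemma pos_word_in_words: "pos_word w \<in> braid_words N \<longleftrightarrow> set w \<subseteq> {1..<N}"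
  by (auto simp: pos_word_def braid_words_def)

lemma pstep_imp_braid_equiv:
  "pstep u v \<Longrightarrow> set u \<subseteq> {1..<N} \<Longrightarrow> braid_equiv N (pos_word u) (pos_word v)"
proof (induction rule: pstep.induct)
  case (far i j u v)
  have "braid_equiv N (pos_word [i, j]) (pos_word [j, i])"
    using far.hyps far.prems braid_equiv.far[of i N j] braid_equiv.sym[OF braid_equiv.far[of j N i]]
    by (auto simp: far_def pos_word_def)
  moreover have "braid_equiv N (pos_word u) (pos_word u)" "braid_equiv N (pos_word v) (pos_word v)"
    using far.prems by (auto intro!: braid_equiv.refl simp: pos_word_in_words)
  ultimately show ?case unfolding pos_word_append by (intro braid_equiv.cong)
next
  case (adj i j u v)
  have "braid_equiv N (pos_word [i, j, i]) (pos_word [j, i, j])"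
    using adj.hyps adj.prems braid_equiv.braid[of i N] braid_equiv.sym[OF braid_equiv.braid[of j N]]
    by (auto simp: adj_def pos_word_def)
  moreover have "braid_equiv N (pos_word u) (pos_word u)" "braid_equiv N (pos_word v) (pos_word v)"
    using adj.prems by (auto intro!: braid_equiv.refl simp: pos_word_in_words)
  ultimately show ?case unfolding pos_word_append by (intro braid_equiv.cong)
qed

lemma peq_imp_braid_equiv:
  "peq u v \<Longrightarrow> set u \<subseteq> {1..<N} \<Longrightarrow> braid_equiv N (pos_word u) (pos_word v)"
proof (induction rule: rtranclp_induct)
  case base
  then show ?case by (simp add: braid_equiv.refl pos_word_in_words)
next
  case (step v w)
  then have "set v \<subseteq> {1..<N}" using peq_invariants by blast
  then show ?case using step pstep_imp_braid_equiv braid_equiv.trans by blast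
qed

text \<open>\<open>T\<close> counts generators, in agreement with the argument of
  \<open>delta\<close>; there are \<open>Suc T\<close> strands.\<close>

locale artin_group = fixes T :: nat
begin

abbreviation N :: nat where "N \<equiv> Suc T"
abbreviation G :: "braid monoid" where "G \<equiv> braid_group N"
abbreviation \<Delta> :: pbraid where "\<Delta> \<equiv> delta T"
definition pos :: "pbraid \<Rightarrow> bool" where "pos x \<longleftrightarrow> supp x \<subseteq> {1..T}"

text \<open>\<open>\<phi>\<close> is meaningful on positive braids with letters in \<open>{1..T}\<close> only.\<close>

definition \<phi> :: "pbraid \<Rightarrow> braid" where
  "\<phi> x = braid_class N (pos_word (SOME w. pword w = x))"

end

sublocale artin_group \<subseteq> group "braid_group (Suc T)" by (rule group_braid_group)

context artin_group
begin

lemma letters: "{1..<N} = {1..T}" by auto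

lemma pos_simps [simp]:
  "pos 1" "pos (x * y) \<longleftrightarrow> pos x \<and> pos y" "pos (gen i) \<longleftrightarrow> 1 \<le> i \<and> i \<le> T" "pos \<Delta>"
  by (auto simp: pos_def)

lemma pos_pword: "pos (pword w) \<longleftrightarrow> set w \<subseteq> {1..<N}"
  unfolding pos_def letters by simp

lemma pos_power [simp]: "pos x \<Longrightarrow> pos (x ^ m)"
  by (induction m) auto

lemma pos_ldvd: "x ldvd y \<Longrightarrow> pos y \<Longrightarrow> pos x"
  using ldvd_supp by (auto simp: pos_def)

lemma phi_pword: "set w \<subseteq> {1..<N} \<Longrightarrow> \<phi> (pword w) = braid_class N (pos_word w)"
proof -
  assume w: "set w \<subseteq> {1..<N}"
  let ?v = "SOME v. pword v = pword w"
  have "pword ?v = pword w" by (rule someI) simp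
  then have "peq w ?v" by (metis pword_eq_iff)
  then have "braid_equiv N (pos_word w) (pos_word ?v)" using peq_imp_braid_equiv w by blast
  then show ?thesis
    unfolding \<phi>_def using braid_class_eq_iff[of "pos_word w" N] w pos_word_in_words by blast
qed

lemma carrier_class: "carrier G = braid_class N ` braid_words N"
  by (simp add: braid_group_def)

lemma one_class: "\<one>\<^bsub>G\<^esub> = braid_class N []"
  by (simp add: braid_group_def)

lemma phi_one [simp]: "\<phi> 1 = \<one>\<^bsub>G\<^esub>"
  using phi_pword[of "[]"] by (simp add: one_class pos_word_def)

lemma phi_closed [simp]: "pos x \<Longrightarrow> \<phi> x \<in> carrier G"
  using ex_pword[of x] phi_pword pos_pword pos_word_in_words carrier_class by auto

lemma phi_mult: "pos x \<Longrightarrow> pos y \<Longrightarrow> \<phi> (x * y) = \<phi> x \<otimes>\<^bsub>G\<^esub> \<phi> y"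
proof -
  assume xy: "pos x" "pos y"
  obtain u v where uv: "x = pword u" "y = pword v" using ex_pword by metis
  then have s: "set u \<subseteq> {1..<N}" "set v \<subseteq> {1..<N}" using xy pos_pword by auto
  have "\<phi> (pword (u @ v)) = braid_class N (pos_word u @ pos_word v)"
    using s by (subst phi_pword) auto
  then show ?thesis
    using s by (simp add: uv phi_pword braid_mult_class pos_word_in_words)
qed

lemma phi_power: "pos x \<Longrightarrow> \<phi> (x ^ m) = \<phi> x [^]\<^bsub>G\<^esub> m"
  by (induction m) (simp_all add: phi_mult power_Suc2 del: power_Suc)

lemma phi_gen: "1 \<le> i \<Longrightarrow> i < N \<Longrightarrow> \<phi> (gen i) = sigma N i"
  using phi_pword[of "[i]"] by (simp add: sigma_def pos_word_def)

lemma positive_braids_eq: "positive_braids N = \<phi> ` {x. pos x}"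
proof
  show "positive_braids N \<subseteq> \<phi> ` {x. pos x}"
  proof
    fix x assume "x \<in> positive_braids N"
    then show "x \<in> \<phi> ` {x. pos x}"
    proof induction
      case one
      then show ?case using phi_one by (metis imageI mem_Collect_eq pos_simps(1))
    next
      case (gen i)
      then have "sigma N i = \<phi> (gen i)" "pos (gen i)" using phi_gen by auto
      then show ?case by blast
    next
      case (mult x y)
      then obtain a b where "x = \<phi> a" "y = \<phi> b" "pos a" "pos b" by blast
      then have "x \<otimes>\<^bsub>G\<^esub> y = \<phi> (a * b)" "pos (a * b)" by (auto simp: phi_mult)
      then show ?case by blast
    qed
  qed
  have "set w \<subseteq> {1..<N} \<Longrightarrow> \<phi> (pword w) \<in> positive_braids N" for w
  proof (induction w)
    case Nil
    then show ?case using positive_braids.one by simp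
  next
    case (Cons i w)
    then have "\<phi> (pword (i # w)) = sigma N i \<otimes>\<^bsub>G\<^esub> \<phi> (pword w)"
      by (simp add: phi_mult phi_gen pos_pword)
    then show ?case using Cons by (simp add: positive_braids.intros)
  qed
  then show "\<phi> ` {x. pos x} \<subseteq> positive_braids N"
    using ex_pword pos_pword by (metis image_subsetI mem_Collect_eq)
qed

text \<open>Multiplying by a power of the central element \<open>\<Delta>\<^sup>2\<close> clears all inverse letters of a word;
  \<open>twist_co i\<close> is the positive braid \<open>\<sigma>\<^sub>i\<inverse> \<Delta>\<^sup>2\<close>.\<close>

definition twist_co :: "nat \<Rightarrow> pbraid" where
  "twist_co i = (SOME c. gen i * c = \<Delta> ^ 2)"

primrec cleared :: "braid_word \<Rightarrow> pbraid" where
  "cleared [] = 1"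
| "cleared (a # w) = (if snd a then gen (fst a) else twist_co (fst a)) * cleared w"

definition negs :: "braid_word \<Rightarrow> nat" where
  "negs w = length (filter (Not \<circ> snd) w)"

lemma twist_co_right: "i \<in> {1..<N} \<Longrightarrow> gen i * twist_co i = \<Delta> ^ 2"
proof -
  assume "i \<in> {1..<N}"
  then have "gen i ldvd \<Delta>" by (intro gen_ldvd_delta) auto
  then have "gen i ldvd \<Delta> ^ 2" by (simp add: power2_eq_square ldvd_mult_right)
  then have "\<exists>c. gen i * c = \<Delta> ^ 2" unfolding ldvd_def by metis
  then show ?thesis unfolding twist_co_def by (rule someI_ex)
qed

lemma twist_central: "pos x \<Longrightarrow> x * \<Delta> ^ (2 * m) = \<Delta> ^ (2 * m) * x"
  unfolding pos_def by (rule delta_sq_central)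

lemma twist_co_left: "i \<in> {1..<N} \<Longrightarrow> twist_co i * gen i = \<Delta> ^ 2"
proof -
  assume i: "i \<in> {1..<N}"
  then have "gen i * (twist_co i * gen i) = \<Delta> ^ 2 * gen i"
    by (simp add: twist_co_right flip: mult.assoc)
  also have "\<dots> = gen i * \<Delta> ^ 2" using twist_central[of "gen i" 1] i by auto
  finally show ?thesis by simp
qed

lemma pos_twist_co: "i \<in> {1..<N} \<Longrightarrow> pos (twist_co i)"
  using twist_co_left[of i] pos_ldvd[of "twist_co i" "\<Delta> ^ 2"] by (metis ldvd_triv pos_power pos_simps(4))

lemma cleared_append: "cleared (u @ v) = cleared u * cleared v"
  by (induction u) (auto simp: mult.assoc)

lemma negs_append: "negs (u @ v) = negs u + negs v"
  by (simp add: negs_def)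

lemma pos_cleared: "w \<in> braid_words N \<Longrightarrow> pos (cleared w)"
  by (induction w) (auto simp: braid_words_def pos_twist_co)

text \<open>A word \<open>w\<close> stands for the fraction with numerator \<open>cleared w\<close>
  and denominator the full twist to the power \<open>negs w\<close>. Equality of fractions is
  cross-multiplied so that it can be stated in the monoid; transitivity then rests on cancellation
  and congruence on centrality.\<close>

lemma braid_equiv_cleared:
  "braid_equiv N u v \<Longrightarrow> \<Delta> ^ (2 * negs v) * cleared u = \<Delta> ^ (2 * negs u) * cleared v"
proof (induction rule: braid_equiv.induct)
  case (trans u v w)
  let ?z = "\<lambda>m. \<Delta> ^ (2 * m)"
  have z: "?z a * (?z b * x) = ?z b * (?z a * x)" for a b x
    by (simp flip: mult.assoc power_add) (simp add: add.commute)
  have "?z (negs v) * (?z (negs w) * cleared u) = ?z (negs w) * (?z (negs u) * cleared v)"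
    using z trans.IH(1) by metis
  also have "\<dots> = ?z (negs u) * (?z (negs v) * cleared w)"
    using z trans.IH(2) by metis
  also have "\<dots> = ?z (negs v) * (?z (negs u) * cleared w)" using z by metis
  finally show ?case by simp
next
  case (cong u u' v v')
  let ?z = "\<lambda>m. \<Delta> ^ (2 * m)"
  have c: "pos (cleared u)" "pos (cleared u')"
    using cong.hyps braid_equiv_words pos_cleared by blast+
  have z: "?z (negs (a @ b)) = ?z (negs a) * ?z (negs b)" for a b
    by (simp add: negs_append power_add add_mult_distrib2)
  have "?z (negs (u' @ v')) * cleared (u @ v)
      = ?z (negs u') * (?z (negs v') * cleared u) * cleared v"
    by (simp add: z cleared_append mult.assoc)
  also have "\<dots> = (?z (negs u') * cleared u) * (?z (negs v') * cleared v)"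
    using twist_central[OF c(1), of "negs v'"] by (metis mult.assoc)
  also have "\<dots> = (?z (negs u) * cleared u') * (?z (negs v) * cleared v')"
    using cong.IH by simp
  also have "\<dots> = ?z (negs u) * (?z (negs v) * cleared u') * cleared v'"
    using twist_central[OF c(2), of "negs v"] by (metis mult.assoc)
  also have "\<dots> = ?z (negs (u @ v)) * cleared (u' @ v')"
    by (simp add: z cleared_append mult.assoc)
  finally show ?case .
next
  case (cancel i b)
  then show ?case by (auto simp: negs_def twist_co_left twist_co_right)
next
  case (far i j)
  then have "far i j" by (simp add: far_def)
  then show ?case using gen_far[of i j 1] by (simp add: negs_def)
next
  case (braid i)
  have "adj i (i + 1)" by (simp add: adj_def)
  then show ?case using gen_adj[of i "i + 1" 1] by (simp add: negs_def)
qed simp_all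

text \<open>Positive words have denominator 1, so equality of their fractions is equality in the
  monoid.\<close>

lemma phi_inject: "pos x \<Longrightarrow> pos y \<Longrightarrow> \<phi> x = \<phi> y \<Longrightarrow> x = y"
proof -
  assume xy: "pos x" "pos y" and eq: "\<phi> x = \<phi> y"
  obtain u v where uv: "x = pword u" "y = pword v" using ex_pword by metis
  then have s: "set u \<subseteq> {1..<N}" "set v \<subseteq> {1..<N}" using xy pos_pword by auto
  have "braid_equiv N (pos_word u) (pos_word v)"
    using eq s unfolding uv by (simp add: phi_pword braid_class_eq_iff pos_word_in_words)
  moreover have "negs (pos_word w) = 0 \<and> cleared (pos_word w) = pword w" for w
    by (induction w) (auto simp: negs_def pos_word_def)
  ultimately show "x = y" using braid_equiv_cleared uv by fastforce
qed

lemma phi_eq_iff: "pos x \<Longrightarrow> pos y \<Longrightarrow> \<phi> x = \<phi> y \<longleftrightarrow> x = y"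
  using phi_inject by blast

text \<open>Every braid is a left fraction of positive ones. The word grows on the right: an inverse
  letter is traded for \<open>twist_co\<close> at the price of one full twist in
  \<open>d\<close>.\<close>

lemma ex_positive_multiple:
  assumes "g \<in> carrier G"
  shows "\<exists>d p. pos d \<and> pos p \<and> \<phi> d \<otimes>\<^bsub>G\<^esub> g = \<phi> p"
proof -
  have "w \<in> braid_words N \<Longrightarrow> \<exists>d p. pos d \<and> pos p \<and> \<phi> d \<otimes>\<^bsub>G\<^esub> braid_class N w = \<phi> p" for w
  proof (induction w rule: rev_induct)
    case Nil
    have "\<phi> 1 \<otimes>\<^bsub>G\<^esub> braid_class N [] = \<phi> 1" by (simp flip: one_class)
    then show ?case using pos_simps(1) by blast
  next
    case (snoc a w)
    obtain i b where a: "a = (i, b)" by (cases a)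
    have i: "i \<in> {1..<N}" and w: "w \<in> braid_words N"
      using snoc.prems a by (auto simp: braid_words_def)
    then obtain d p where dp: "pos d" "pos p" "\<phi> d \<otimes>\<^bsub>G\<^esub> braid_class N w = \<phi> p"
      using snoc.IH by blast
    have wc: "braid_class N w \<in> carrier G" using w by (simp add: carrier_class)
    have posi: "pos (gen i)" "pos (twist_co i)" using i pos_twist_co by auto
    have aw: "[(i, c)] \<in> braid_words N" for c using i by (auto simp: braid_words_def)
    have split: "braid_class N (w @ [a]) = braid_class N w \<otimes>\<^bsub>G\<^esub> braid_class N [(i, b)]"
      using a braid_mult_class[OF w aw] by simp
    have step: "\<phi> d \<otimes>\<^bsub>G\<^esub> braid_class N (w @ [a]) = \<phi> p \<otimes>\<^bsub>G\<^esub> braid_class N [(i, b)]"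
      unfolding split using dp wc aw
      by (metis carrier_class imageI m_assoc phi_closed)
    show ?case
    proof (cases b)
      case True
      then have "\<phi> d \<otimes>\<^bsub>G\<^esub> braid_class N (w @ [a]) = \<phi> (p * gen i)"
        using step dp posi i by (simp add: phi_mult phi_gen sigma_def)
      moreover have "pos (p * gen i)" using dp posi by simp
      ultimately show ?thesis using dp by blast
    next
      case False
      let ?s = "braid_class N [(i, False)]"
      have sc: "?s \<in> carrier G" using aw by (simp add: carrier_class)
      have "braid_class N ([(i, True)] @ [(i, False)]) = \<one>\<^bsub>G\<^esub>"
        using braid_class_eq_iff[of "[(i, True), (i, False)]" N "[]"] braid_equiv.cancel[OF i, of True] aw
        by (simp add: one_class braid_words_def)
      then have inv: "\<phi> (gen i) \<otimes>\<^bsub>G\<^esub> ?s = \<one>\<^bsub>G\<^esub>"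
        using braid_mult_class[OF aw[of True] aw[of False]] i by (simp add: phi_gen sigma_def)
      have "braid_class N (w @ [a]) \<in> carrier G" using split wc False sc by simp
      then have "\<phi> (\<Delta> ^ 2 * d) \<otimes>\<^bsub>G\<^esub> braid_class N (w @ [a])
          = \<phi> (\<Delta> ^ 2) \<otimes>\<^bsub>G\<^esub> (\<phi> d \<otimes>\<^bsub>G\<^esub> braid_class N (w @ [a]))"
        using dp by (simp add: phi_mult m_assoc)
      also have "\<dots> = \<phi> (\<Delta> ^ 2) \<otimes>\<^bsub>G\<^esub> (\<phi> p \<otimes>\<^bsub>G\<^esub> ?s)"
        using step False by simp
      also have "\<dots> = \<phi> (\<Delta> ^ 2 * p) \<otimes>\<^bsub>G\<^esub> ?s"
        using dp sc by (simp add: phi_mult m_assoc)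
      also have "\<Delta> ^ 2 * p = p * (twist_co i * gen i)"
        using twist_central[OF dp(2), of 1] twist_co_left[OF i] by simp
      also have "\<phi> (p * (twist_co i * gen i)) \<otimes>\<^bsub>G\<^esub> ?s = \<phi> (p * twist_co i)"
        using dp posi sc inv by (simp add: phi_mult m_assoc)
      finally have "\<phi> (\<Delta> ^ 2 * d) \<otimes>\<^bsub>G\<^esub> braid_class N (w @ [a]) = \<phi> (p * twist_co i)" .
      moreover have "pos (\<Delta> ^ 2 * d)" "pos (p * twist_co i)" using dp posi by simp_all
      ultimately show ?thesis by blast
    qed
  qed
  then show ?thesis using assms by (auto simp: carrier_class)
qed

section \<open>The prefix order and its meets\<close>

abbreviation gle :: "braid \<Rightarrow> braid \<Rightarrow> bool" where
  "gle a b \<equiv> inv\<^bsub>G\<^esub> a \<otimes>\<^bsub>G\<^esub> b \<in> positive_braids N"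

lemma gle_iff:
  "a \<in> carrier G \<Longrightarrow> b \<in> carrier G \<Longrightarrow> gle a b \<longleftrightarrow> (\<exists>p. pos p \<and> b = a \<otimes>\<^bsub>G\<^esub> \<phi> p)"
proof -
  assume ab: "a \<in> carrier G" "b \<in> carrier G"
  have "gle a b \<longleftrightarrow> (\<exists>p. pos p \<and> inv\<^bsub>G\<^esub> a \<otimes>\<^bsub>G\<^esub> b = \<phi> p)"
    unfolding positive_braids_eq by blast
  then show ?thesis using ab inv_solve_left' phi_closed by metis
qed

lemma gle_phi: "pos x \<Longrightarrow> pos y \<Longrightarrow> gle (\<phi> x) (\<phi> y) \<longleftrightarrow> x ldvd y"
proof -
  assume xy: "pos x" "pos y"
  have "(\<exists>p. pos p \<and> \<phi> y = \<phi> x \<otimes>\<^bsub>G\<^esub> \<phi> p) \<longleftrightarrow> (\<exists>p. pos p \<and> \<phi> y = \<phi> (x * p))"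
    using xy phi_mult by metis
  also have "\<dots> \<longleftrightarrow> (\<exists>p. pos p \<and> y = x * p)"
    using xy phi_eq_iff by (metis pos_simps(2))
  also have "\<dots> \<longleftrightarrow> x ldvd y" using xy by (auto simp: ldvd_def)
  finally show ?thesis using gle_iff xy by simp
qed

lemma gle_antisym:
  assumes "a \<in> carrier G" "b \<in> carrier G" "gle a b" "gle b a"
  shows "a = b"
proof -
  obtain p q where p: "pos p" "b = a \<otimes>\<^bsub>G\<^esub> \<phi> p" and q: "pos q" "a = b \<otimes>\<^bsub>G\<^esub> \<phi> q"
    using assms gle_iff by metis
  have "a \<otimes>\<^bsub>G\<^esub> \<one>\<^bsub>G\<^esub> = a \<otimes>\<^bsub>G\<^esub> \<phi> (p * q)"
  proof -
    have "a \<otimes>\<^bsub>G\<^esub> \<phi> (p * q) = (a \<otimes>\<^bsub>G\<^esub> \<phi> p) \<otimes>\<^bsub>G\<^esub> \<phi> q"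
      using p(1) q(1) assms(1) by (simp add: phi_mult m_assoc)
    also have "\<dots> = a" by (simp flip: p(2) q(2))
    finally show ?thesis using assms(1) by simp
  qed
  then have "\<phi> 1 = \<phi> (p * q)" using assms(1) p(1) q(1) Units_l_cancel[of a "\<one>\<^bsub>G\<^esub>" "\<phi> (p * q)"] by simp
  then have "p * q = 1" using phi_inject[of 1 "p * q"] p q by simp
  then show ?thesis using pbraid_mult_eq_1[of p q] p assms by simp
qed

lemma braid_meet_eqI:
  assumes c: "c \<in> carrier G" "gle c a" "gle c b" and ab: "a \<in> carrier G" "b \<in> carrier G"
    and max: "\<And>u. u \<in> carrier G \<Longrightarrow> gle u a \<Longrightarrow> gle u b \<Longrightarrow> gle u c"
  shows "braid_meet N a b = c"
proof -
  let ?L = "braid_order N"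
  have low: "Lower ?L {a, b} = {u \<in> carrier G. gle u a \<and> gle u b}"
    using ab by (auto simp: Lower_def braid_order_def)
  have "greatest ?L x (Lower ?L {a, b}) \<longleftrightarrow> x = c" for x
  proof
    assume "greatest ?L x (Lower ?L {a, b})"
    then have x: "x \<in> carrier G" "gle x a" "gle x b" "gle c x"
      using c unfolding greatest_def low by (auto simp: braid_order_def)
    then show "x = c" using max gle_antisym c by blast
  next
    assume "x = c"
    then show "greatest ?L x (Lower ?L {a, b})"
      using c max unfolding greatest_def low by (auto simp: braid_order_def)
  qed
  then show ?thesis by (simp add: braid_meet_def meet_def Lattice.inf_def)
qed

text \<open>The hypothesis \<open>max\<close> speaks of positive braids, but a lower bound
  \<open>u\<close> in the group may be any braid. Multiplication by a positive \<open>c\<close>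
  makes it a positive \<open>p\<close> dividing \<open>c * x\<close> and \<open>c * y\<close>. Their
  gcd has the form \<open>c * h\<close> with \<open>h\<close> dividing \<open>d\<close>, so
  \<open>p\<close> divides \<open>c * d\<close>, and \<open>c\<close> cancels in the group.\<close>

lemma braid_meet_phi:
  assumes xy: "pos x" "pos y" and d: "d ldvd x" "d ldvd y"
    and max: "\<And>u. u ldvd x \<Longrightarrow> u ldvd y \<Longrightarrow> u ldvd d"
  shows "braid_meet N (\<phi> x) (\<phi> y) = \<phi> d"
proof (rule braid_meet_eqI)
  have "pos d" using d(1) xy(1) by (rule pos_ldvd)
  then show "\<phi> d \<in> carrier G" "gle (\<phi> d) (\<phi> x)" "gle (\<phi> d) (\<phi> y)"
    using d xy gle_phi by auto
  fix u assume u: "u \<in> carrier G" "gle u (\<phi> x)" "gle u (\<phi> y)"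
  obtain c p where cp: "pos c" "pos p" "\<phi> c \<otimes>\<^bsub>G\<^esub> u = \<phi> p" using ex_positive_multiple u(1) by blast
  have dvd: "p ldvd c * z" if z: "pos z" "gle u (\<phi> z)" for z
  proof -
    obtain q where q: "pos q" "\<phi> z = u \<otimes>\<^bsub>G\<^esub> \<phi> q"
      using z gle_iff[OF u(1) phi_closed[OF z(1)]] by blast
    have "\<phi> (c * z) = \<phi> c \<otimes>\<^bsub>G\<^esub> (u \<otimes>\<^bsub>G\<^esub> \<phi> q)" using cp(1) z(1) q(2) by (simp add: phi_mult)
    also have "\<dots> = (\<phi> c \<otimes>\<^bsub>G\<^esub> u) \<otimes>\<^bsub>G\<^esub> \<phi> q" using cp(1) u(1) q(1) by (simp add: m_assoc)
    also have "\<dots> = \<phi> (p * q)" unfolding cp(3) using cp(2) q(1) by (simp add: phi_mult)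
    finally have "c * z = p * q" using phi_inject[of "c * z" "p * q"] cp q(1) z by simp
    then show ?thesis by simp
  qed
  obtain e where e: "e ldvd c * x" "e ldvd c * y" "\<And>w. w ldvd c * x \<Longrightarrow> w ldvd c * y \<Longrightarrow> w ldvd e"
    using ex_gcd by metis
  obtain h where h: "e = c * h" using e(3)[of c] by (auto simp: ldvd_def)
  then have "h ldvd d" using e(1,2) max by simp
  moreover have "p ldvd c * h" using e(3)[OF dvd[OF xy(1) u(2)] dvd[OF xy(2) u(3)]] h by simp
  ultimately have "p ldvd c * d" by (meson ldvd_trans mult_ldvd_cancel)
  then obtain q where q: "c * d = p * q" by (auto simp: ldvd_def)
  then have "pos (p * q)" using cp(1) \<open>pos d\<close> pos_simps(2)[of c d] by simp
  then have "pos q" by simp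
  have "\<phi> c \<otimes>\<^bsub>G\<^esub> \<phi> d = (\<phi> c \<otimes>\<^bsub>G\<^esub> u) \<otimes>\<^bsub>G\<^esub> \<phi> q"
    unfolding cp(3) using q cp(1,2) \<open>pos q\<close> \<open>pos d\<close> by (simp flip: phi_mult)
  also have "\<dots> = \<phi> c \<otimes>\<^bsub>G\<^esub> (u \<otimes>\<^bsub>G\<^esub> \<phi> q)" using cp(1) u(1) \<open>pos q\<close> by (simp add: m_assoc)
  finally have "\<phi> d = u \<otimes>\<^bsub>G\<^esub> \<phi> q" using cp(1) \<open>pos q\<close> \<open>pos d\<close> u(1) by simp
  then show "gle u (\<phi> d)"
    using gle_iff[OF u(1) phi_closed[OF \<open>pos d\<close>]] \<open>pos q\<close> by blast
qed (use xy in simp_all)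

lemma ex_braid_meet_phi:
  assumes "pos x" "pos y"
  obtains d where "braid_meet N (\<phi> x) (\<phi> y) = \<phi> d" "pos d" "d ldvd x" "d ldvd y"
    "\<And>u. u ldvd x \<Longrightarrow> u ldvd y \<Longrightarrow> u ldvd d"
  using ex_gcd[of x y] braid_meet_phi[OF assms] pos_ldvd assms by metis

lemma braid_prod_phi: "(\<And>x. x \<in> set xs \<Longrightarrow> pos x) \<Longrightarrow> pos (prod_list xs) \<and> braid_prod N (map \<phi> xs) = \<phi> (prod_list xs)"
  by (induction xs) (auto simp: braid_prod_def phi_mult)

lemma braid_prod_sigma: "set w \<subseteq> {1..<N} \<Longrightarrow> braid_prod N (map (sigma N) w) = \<phi> (pword w)"
proof (induction w)
  case (Cons i w)
  then show ?case by (simp add: braid_prod_def phi_mult phi_gen pos_pword)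
qed (simp add: braid_prod_def)

lemma garside_Delta_eq: "garside_Delta N = \<phi> \<Delta>"
proof -
  have "map (\<lambda>i. braid_prod N (map (sigma N) (rev [1..<Suc i]))) [1..<N] = map \<phi> (map down [1..<N])"
    unfolding map_map
  proof (rule map_cong[OF HOL.refl])
    fix i assume "i \<in> set [1..<N]"
    then show "braid_prod N (map (sigma N) (rev [1..<Suc i])) = (\<phi> \<circ> down) i"
      by (subst braid_prod_sigma) (auto simp: down_def)
  qed
  moreover have "pos x" if "x \<in> set (map down [1..<N])" for x
    using that unfolding pos_def set_map by (auto simp del: upt_Suc)
  then have "braid_prod N (map \<phi> (map down [1..<N])) = \<phi> (prod_list (map down [1..<N]))"
    using braid_prod_phi by blast
  moreover have "prod_list (map down [1..<Suc t]) = delta t" for t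
    by (induction t) simp_all
  ultimately show ?thesis unfolding garside_Delta_def by metis
qed

lemma Delta_power [simp]: "garside_Delta N [^]\<^bsub>G\<^esub> (int m) = \<phi> (\<Delta> ^ m)"
  unfolding garside_Delta_eq by (simp add: phi_power int_pow_int)

lemma Delta_carrier [simp]: "garside_Delta N \<in> carrier G"
  unfolding garside_Delta_eq by simp

section \<open>Left normal forms\<close>

definition is_inf :: "braid \<Rightarrow> int \<Rightarrow> bool" where
  "is_inf x p \<longleftrightarrow> garside_Delta N [^]\<^bsub>G\<^esub> (- p) \<otimes>\<^bsub>G\<^esub> x \<in> positive_braids N \<and>
    (\<forall>q::int. garside_Delta N [^]\<^bsub>G\<^esub> (- q) \<otimes>\<^bsub>G\<^esub> x \<in> positive_braids N \<longrightarrow> q \<le> p)"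

definition weighted :: "braid list \<Rightarrow> bool" where
  "weighted xs \<longleftrightarrow> set xs \<subseteq> carrier G \<and>
    (\<forall>i<length xs. xs ! i \<noteq> \<one>\<^bsub>G\<^esub> \<and>
       xs ! i = braid_meet N (braid_prod N (drop i xs)) (garside_Delta N))"

lemma left_normal_form_iff:
  "left_normal_form N x p xs \<longleftrightarrow> weighted xs \<and> is_inf x p \<and>
    x = garside_Delta N [^]\<^bsub>G\<^esub> p \<otimes>\<^bsub>G\<^esub> braid_prod N xs"
  unfolding left_normal_form_def weighted_def is_inf_def by blast

lemma weighted_Nil [simp]: "weighted []"
  by (simp add: weighted_def)

lemma weighted_Cons:
  "weighted (x # xs) \<longleftrightarrow> x \<in> carrier G \<and> x \<noteq> \<one>\<^bsub>G\<^esub> \<and>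
    x = braid_meet N (braid_prod N (x # xs)) (garside_Delta N) \<and> weighted xs"
  unfolding weighted_def by (auto simp: All_less_Suc2)

lemma braid_prod_closed: "set xs \<subseteq> carrier G \<Longrightarrow> braid_prod N xs \<in> carrier G"
  by (induction xs) (auto simp: braid_prod_def)

lemma weighted_closed: "weighted xs \<Longrightarrow> braid_prod N xs \<in> carrier G"
  by (rule braid_prod_closed) (simp add: weighted_def)

lemma braid_prod_Nil [simp]: "braid_prod N [] = \<one>\<^bsub>G\<^esub>"
  and braid_prod_Cons: "braid_prod N (x # xs) = x \<otimes>\<^bsub>G\<^esub> braid_prod N xs"
  by (simp_all add: braid_prod_def)

lemma braid_meet_one: "braid_meet N \<one>\<^bsub>G\<^esub> (garside_Delta N) = \<one>\<^bsub>G\<^esub>"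
  using braid_meet_phi[of 1 \<Delta> 1] by (simp add: garside_Delta_eq)

text \<open>The head is the meet of the product with the half twist, so the product determines it,
  and cancellation passes on to the tails. A nonempty list cannot have product 1, since its head
  would be trivial.\<close>

lemma weighted_unique:
  "weighted xs \<Longrightarrow> weighted ys \<Longrightarrow> braid_prod N xs = braid_prod N ys \<Longrightarrow> xs = ys"
proof (induction xs arbitrary: ys)
  case Nil
  then show ?case using braid_meet_one by (cases ys) (auto simp: weighted_Cons)
next
  case (Cons x xs)
  show ?case
  proof (cases ys)
    case Nil
    then show ?thesis using Cons.prems braid_meet_one by (auto simp: weighted_Cons)
  next
    case ys: (Cons y zs)
    have "x = braid_meet N (braid_prod N (x # xs)) (garside_Delta N)"
      "y = braid_meet N (braid_prod N (y # zs)) (garside_Delta N)"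
      using Cons.prems(1,2) unfolding ys weighted_Cons by blast+
    then have xy: "x = y" using Cons.prems(3) ys by simp
    have "x \<in> carrier G" "weighted xs" "weighted zs" using Cons.prems ys by (auto simp: weighted_Cons)
    moreover have "braid_prod N xs = braid_prod N zs"
      using Cons.prems(3) xy ys calculation weighted_closed by (simp add: braid_prod_Cons)
    ultimately show ?thesis using Cons.IH xy ys by blast
  qed
qed

lemma is_inf_unique: "is_inf x p \<Longrightarrow> is_inf x q \<Longrightarrow> p = q"
  unfolding is_inf_def by (meson order_antisym)

text \<open>\<open>braid_inf\<close> and \<open>canonical_length\<close> are definite descriptions;
  this is the uniqueness they depend on.\<close>

lemma left_normal_form_unique:
  assumes "left_normal_form N x p xs" "left_normal_form N x q ys"
  shows "p = q \<and> xs = ys"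
proof -
  have pq: "p = q" using assms is_inf_unique unfolding left_normal_form_iff by blast
  have "garside_Delta N [^]\<^bsub>G\<^esub> p \<otimes>\<^bsub>G\<^esub> braid_prod N xs = garside_Delta N [^]\<^bsub>G\<^esub> p \<otimes>\<^bsub>G\<^esub> braid_prod N ys"
    using assms pq unfolding left_normal_form_iff by metis
  then have "braid_prod N xs = braid_prod N ys"
    using assms weighted_closed unfolding left_normal_form_iff by simp
  then show ?thesis using assms weighted_unique pq unfolding left_normal_form_iff by blast
qed

text \<open>The greedy algorithm: a first letter of \<open>x\<close> also divides the half twist, so
  the meet splits off a nontrivial factor and the length drops.\<close>

lemma ex_weighted: "pos x \<Longrightarrow> \<exists>xs. weighted xs \<and> braid_prod N xs = \<phi> x"
proof (induction "plen x" arbitrary: x rule: less_induct)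
  case less
  show ?case
  proof (cases x rule: pbraid_cases)
    case 1
    then show ?thesis by (intro exI[of _ "[]"]) simp
  next
    case (2 i y)
    obtain d where d: "braid_meet N (\<phi> x) (\<phi> \<Delta>) = \<phi> d" "pos d" "d ldvd x"
      "\<And>u. u ldvd x \<Longrightarrow> u ldvd \<Delta> \<Longrightarrow> u ldvd d"
      using ex_braid_meet_phi[OF less.prems pos_simps(4)] by metis
    obtain z where z: "x = d * z" using d(3) by (auto simp: ldvd_def)
    have "gen i ldvd d" using d(4)[of "gen i"] 2 less.prems gen_ldvd_delta by auto
    then have "d \<noteq> 1" by auto
    then have "plen z < plen x" using z plen_eq_0 by auto
    moreover have "pos z" using z less.prems by simp
    ultimately obtain xs where xs: "weighted xs" "braid_prod N xs = \<phi> z" using less.hyps by blast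
    have "braid_prod N (\<phi> d # xs) = \<phi> x"
      using xs d(2) \<open>pos z\<close> by (simp add: braid_prod_Cons z phi_mult)
    moreover have "\<phi> d \<noteq> \<one>\<^bsub>G\<^esub>" using phi_inject[of d 1] d(2) \<open>d \<noteq> 1\<close> by auto
    ultimately show ?thesis using xs d(1,2) unfolding garside_Delta_eq[symmetric]
      by (intro exI[of _ "\<phi> d # xs"]) (simp add: weighted_Cons)
  qed
qed

lemma ex_left_normal_form:
  assumes x: "x \<in> carrier G" and p: "is_inf x p"
  shows "\<exists>xs. left_normal_form N x p xs"
proof -
  obtain y where y: "pos y" "garside_Delta N [^]\<^bsub>G\<^esub> (- p) \<otimes>\<^bsub>G\<^esub> x = \<phi> y"
    using p unfolding is_inf_def positive_braids_eq by blast
  then obtain xs where xs: "weighted xs" "braid_prod N xs = \<phi> y" using ex_weighted by blast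
  have "x = garside_Delta N [^]\<^bsub>G\<^esub> p \<otimes>\<^bsub>G\<^esub> braid_prod N xs"
    unfolding xs(2) y(2)[symmetric] using x by (simp add: int_pow_neg flip: m_assoc)
  then show ?thesis using p xs(1) unfolding left_normal_form_iff by blast
qed

lemma braid_inf_eq:
  assumes "x \<in> carrier G" "is_inf x p"
  shows "braid_inf N x = p"
  unfolding braid_inf_def
  using ex_left_normal_form[OF assms] left_normal_form_unique by blast

lemma canonical_length_eq:
  assumes "left_normal_form N x p xs"
  shows "canonical_length N x = length xs"
  unfolding canonical_length_def
  using assms left_normal_form_unique by blast

text \<open>A criterion on last letters replaces the computation of meets: if the gcd with the half
  twist were \<open>x * v\<close> with \<open>v\<close> beginning in \<open>j\<close>, then
  \<open>j\<close> occurs in \<open>xs\<close>, so \<open>x\<close> ends in \<open>j\<close>, and a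
  divisor of the half twist would contain a square.\<close>

lemma weighted_phi:
  assumes "weighted (map \<phi> xs)" "\<And>z. z \<in> set xs \<Longrightarrow> pos z" "pos x" "x \<noteq> 1" "x ldvd \<Delta>"
    and "\<And>j. j \<in> supp (prod_list xs) \<Longrightarrow> \<exists>w. x = w * gen j"
  shows "weighted (map \<phi> (x # xs))"
proof -
  have xs: "pos (prod_list xs)" "braid_prod N (map \<phi> xs) = \<phi> (prod_list xs)"
    using braid_prod_phi[of xs] assms(2) by auto
  have "u ldvd x" if u: "u ldvd x * prod_list xs" "u ldvd \<Delta>" for u
  proof -
    obtain d where d: "d ldvd x * prod_list xs" "d ldvd \<Delta>"
      "\<And>u. u ldvd x * prod_list xs \<Longrightarrow> u ldvd \<Delta> \<Longrightarrow> u ldvd d"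
      using ex_gcd by metis
    obtain v where v: "d = x * v" using d(3)[of x] assms(5) by (auto simp: ldvd_def)
    have "v = 1"
    proof (cases v rule: pbraid_cases)
      case (2 j v')
      have "v ldvd prod_list xs" using d(1) v by simp
      then have "j \<in> supp (prod_list xs)" using ldvd_supp[of v] 2 by auto
      then obtain w where "x = w * gen j" using assms(6) by blast
      then have "w * (gen j * (gen j * v')) = d" using v 2 by (simp add: mult.assoc)
      then show ?thesis using d(2) gen_sq_not_factor unfolding ldvd_def by (metis mult.assoc)
    qed
    then show ?thesis using d(3) u v by simp
  qed
  then have "braid_meet N (\<phi> (x * prod_list xs)) (\<phi> \<Delta>) = \<phi> x"
    using assms(3,5) xs(1) by (intro braid_meet_phi) simp_all
  moreover have "\<phi> x \<noteq> \<one>\<^bsub>G\<^esub>" using phi_inject[of x 1] assms(3,4) by auto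
  ultimately show ?thesis
    using assms(1,3) xs by (simp add: weighted_Cons braid_prod_Cons garside_Delta_eq phi_mult)
qed

end

section \<open>Sliding circuits\<close>

lemma supp_power: "supp (x ^ m) \<subseteq> supp x"
  by (induction m) auto

lemma supp_prod_list: "supp (prod_list xs) = (\<Union>x\<in>set xs. supp x)"
  by (induction xs) auto

lemma commute_mult_power: "x * y = y * (x :: pbraid) \<Longrightarrow> (x * y) ^ m = x ^ m * y ^ m"
proof (induction m)
  case (Suc m)
  have "y * x ^ m = x ^ m * y"
    by (induction m) (simp_all add: mult.assoc flip: Suc.prems, metis Suc.prems mult.assoc)
  then show ?case using Suc by (simp add: mult.assoc) (metis mult.assoc)
qed simp

lemma power_ldvd_delta_power: "x ldvd delta T \<Longrightarrow> x ^ m ldvd delta T ^ m"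
proof (induction m)
  case (Suc m)
  then show ?case using mult_ldvd_delta_power[of x T 1 "x ^ m" m] by simp
qed simp

lemma gen_top_commute:
  "supp x \<subseteq> {1..t} \<Longrightarrow> x * gen (Suc (Suc t)) ^ r = gen (Suc (Suc t)) ^ r * x"
  by (rule supp_far_commute) (use supp_power in \<open>fastforce simp: far_def\<close>)

text \<open>The larger half twist contains \<open>delta t\<close> directly followed by the letter
  \<open>t + 2\<close>. The complement of \<open>x\<close> in \<open>delta t\<close> commutes with
  that letter, so \<open>x\<close> and the letter become neighbours.\<close>

lemma mult_gen_ldvd_delta:
  assumes "x ldvd delta t"
  shows "x * gen (Suc (Suc t)) ldvd delta (Suc (Suc t))"
proof -
  let ?s = "Suc (Suc t)"
  obtain y where y: "delta t = x * y" using assms by (auto simp: ldvd_def)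
  have "supp y \<subseteq> supp (delta t)" using y by auto
  then have c: "y * gen ?s = gen ?s * y" using gen_top_commute[of y t 1] by simp
  have "delta ?s = up (Suc t) * (x * y) * (gen ?s * down (Suc t))"
    by (subst delta.simps(2), subst delta_Suc_up) (simp only: down_Suc y)
  also have "\<dots> = up (Suc t) * x * (y * gen ?s) * down (Suc t)" by (simp add: mult.assoc)
  also have "\<dots> = up (Suc t) * (x * gen ?s) * (y * down (Suc t))" by (simp add: c mult.assoc)
  finally have "up (Suc t) * (x * gen ?s) * (y * down (Suc t)) = delta ?s ^ 1" by simp
  then have "x * gen ?s ldvd delta ?s ^ 1" by (rule factor_ldvd_delta_power)
  then show ?thesis by (simp only: power_one_right)
qed

lemma gen_right_factor_delta: "1 \<le> j \<Longrightarrow> j \<le> t \<Longrightarrow> \<exists>w. delta t = w * gen j"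
  using ldvd_delta_power_right[of "gen j" t 1] gen_ldvd_delta[of j t] by (simp, metis)

section \<open>Infima, preferred prefixes and slidings\<close>

context artin_group
begin

lemma is_inf_0:
  assumes x: "pos x" and T: "T \<noteq> 0" and s: "\<not> {1..T} \<subseteq> supp x"
  shows "is_inf (\<phi> x) 0"
  unfolding is_inf_def
proof (intro conjI allI impI)
  show "garside_Delta N [^]\<^bsub>G\<^esub> (- 0::int) \<otimes>\<^bsub>G\<^esub> \<phi> x \<in> positive_braids N"
    using x by (simp add: positive_braids_eq)
  fix q :: int
  assume "garside_Delta N [^]\<^bsub>G\<^esub> (- q) \<otimes>\<^bsub>G\<^esub> \<phi> x \<in> positive_braids N"
  then obtain p where p: "pos p" "garside_Delta N [^]\<^bsub>G\<^esub> (- q) \<otimes>\<^bsub>G\<^esub> \<phi> x = \<phi> p"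
    unfolding positive_braids_eq by blast
  show "q \<le> 0"
  proof (rule ccontr)
    assume "\<not> q \<le> 0"
    then obtain m where m: "q = int (Suc m)" by (metis not_le zero_less_imp_eq_int gr0_conv_Suc)
    have "inv\<^bsub>G\<^esub> (\<phi> (\<Delta> ^ Suc m)) \<otimes>\<^bsub>G\<^esub> \<phi> x = \<phi> p"
      using p(2) unfolding m int_pow_neg[OF Delta_carrier] Delta_power .
    then have "\<phi> x = \<phi> (\<Delta> ^ Suc m) \<otimes>\<^bsub>G\<^esub> \<phi> p"
      using inv_solve_left'[of "\<phi> p" "\<phi> (\<Delta> ^ Suc m)" "\<phi> x"] x p(1) by simp
    also have "\<dots> = \<phi> (\<Delta> * (\<Delta> ^ m * p))" using p(1) by (simp add: phi_mult m_assoc)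
    finally have "x = \<Delta> * (\<Delta> ^ m * p)"
      using phi_inject[of x "\<Delta> * (\<Delta> ^ m * p)"] x p(1) by simp
    then show False using s by auto
  qed
qed

text \<open>The least \<open>r\<close> is the supremum of \<open>Y\<close>, and inversion turns the
  supremum into the negated infimum. A positive exponent \<open>q\<close> would give a product equal
  to 1 with the nontrivial factor \<open>Y\<close>.\<close>

lemma is_inf_inv:
  assumes Y: "pos Y" "Y \<noteq> 1" "Y ldvd \<Delta> ^ r" and least: "\<And>m. Y ldvd \<Delta> ^ m \<Longrightarrow> r \<le> m"
  shows "is_inf (inv\<^bsub>G\<^esub> (\<phi> Y)) (- int r)"
  unfolding is_inf_def
proof (intro conjI allI impI)
  obtain u where u: "u * Y = \<Delta> ^ r" using ldvd_delta_power_right Y(3) by blast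
  then have pu: "pos u" using pos_ldvd[of u "\<Delta> ^ r"] by (metis ldvd_triv pos_power pos_simps(4))
  have "\<phi> (\<Delta> ^ r) \<otimes>\<^bsub>G\<^esub> inv\<^bsub>G\<^esub> (\<phi> Y) = \<phi> u"
    using u Y(1) pu by (simp add: inv_solve_right' phi_mult flip: u)
  then show "garside_Delta N [^]\<^bsub>G\<^esub> (- (- int r)) \<otimes>\<^bsub>G\<^esub> inv\<^bsub>G\<^esub> (\<phi> Y) \<in> positive_braids N"
    using pu by (simp add: positive_braids_eq)
  fix q :: int
  assume "garside_Delta N [^]\<^bsub>G\<^esub> (- q) \<otimes>\<^bsub>G\<^esub> inv\<^bsub>G\<^esub> (\<phi> Y) \<in> positive_braids N"
  then obtain p where p: "pos p"
      "garside_Delta N [^]\<^bsub>G\<^esub> (- q) \<otimes>\<^bsub>G\<^esub> inv\<^bsub>G\<^esub> (\<phi> Y) = \<phi> p"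
    unfolding positive_braids_eq by blast
  then have eq: "garside_Delta N [^]\<^bsub>G\<^esub> (- q) = \<phi> (p * Y)"
    using Y(1) by (simp add: inv_solve_right' phi_mult)
  show "q \<le> - int r"
  proof (cases "q \<le> 0")
    case True
    then obtain m where m: "q = - int m" using nonpos_int_cases by blast
    then have "\<Delta> ^ m = p * Y" using eq Y(1) p(1) phi_inject[of "\<Delta> ^ m" "p * Y"] by simp
    then have "Y ldvd \<Delta> ^ m" using ldvd_delta_power_rotate[of p Y] unfolding ldvd_def by metis
    then show ?thesis using least m by simp
  next
    case False
    then obtain m where m: "q = int m" by (metis nonneg_int_cases not_le order_less_imp_le)
    have "\<phi> (p * Y * \<Delta> ^ m) = \<phi> (p * Y) \<otimes>\<^bsub>G\<^esub> \<phi> (\<Delta> ^ m)"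
      using p(1) Y(1) by (intro phi_mult) simp_all
    also have "\<dots> = \<phi> 1"
      unfolding eq[symmetric] m int_pow_neg[OF Delta_carrier] Delta_power by simp
    finally have "p * Y * \<Delta> ^ m = 1"
      using p(1) Y(1) phi_inject[of "p * Y * \<Delta> ^ m" 1] by simp
    then show ?thesis using pbraid_mult_eq_1 Y(2) by metis
  qed
qed

text \<open>With \<open>W\<close> the complement of \<open>Z * gen T ^ r\<close> in
  \<open>\<Delta> ^ r\<close>, the prefix is the gcd of both with \<open>\<Delta>\<close>. It
  contains \<open>delta t\<close> because one more \<open>delta t\<close> fits behind
  \<open>Z\<close>. A further letter up to \<open>t\<close> would create a square in
  \<open>\<Delta>\<close>, and the letter \<open>T\<close> would put \<open>gen T ^ Suc r\<close>
  into \<open>\<Delta> ^ r\<close>.\<close>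

lemma preferred_prefix_eq:
  assumes T: "T = Suc (Suc t)" and Z: "delta t ldvd Z" "Z * delta t ldvd delta t ^ r" and r: "r > 0"
  shows "preferred_prefix N (\<phi> (Z * gen T ^ r)) = \<phi> (delta t)"
proof -
  let ?g = "gen T ^ r" and ?Y = "Z * gen T ^ r"
  have sZ: "supp Z \<subseteq> {1..t}" using supp_ldvd_delta_power[OF Z(2)] by simp
  have comm: "x * gen T ^ m = gen T ^ m * x" if "supp x \<subseteq> {1..t}" for x m
    unfolding T using gen_top_commute[OF that] .
  have sY: "supp ?Y \<subseteq> {1..t} \<union> {T}" using sZ supp_power[of "gen T" r] by auto
  have pY: "pos ?Y" unfolding pos_def using sY T by auto
  have dd: "delta t ldvd \<Delta>" by (rule delta_mono) (simp add: T)
  have "delta t ^ r * ?g = (delta t * gen T) ^ r"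
    by (rule commute_mult_power[symmetric]) (use comm[of "delta t" 1] in simp)
  also have "\<dots> ldvd \<Delta> ^ r"
    by (rule power_ldvd_delta_power) (use mult_gen_ldvd_delta[of "delta t" t] T in simp)
  finally have "delta t ^ r * ?g ldvd \<Delta> ^ r" .
  moreover have "?Y * delta t ldvd delta t ^ r * ?g"
  proof -
    obtain V where V: "delta t ^ r = Z * delta t * V" using Z(2) by (auto simp: ldvd_def)
    have "supp V \<subseteq> supp (delta t ^ r)" using V by auto
    then have sV: "supp V \<subseteq> {1..t}" using supp_power[of "delta t" r] by auto
    have "delta t ^ r * ?g = Z * delta t * (?g * V)" unfolding V using comm[OF sV] by (simp add: mult.assoc)
    also have "\<dots> = ?Y * delta t * V" using comm[of "delta t" r] by (simp add: mult.assoc) (metis mult.assoc)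
    finally show ?thesis by simp
  qed
  ultimately have YD: "?Y * delta t ldvd \<Delta> ^ r" by (rule ldvd_trans[rotated])
  then have "?Y ldvd \<Delta> ^ r" by (rule mult_ldvd_left)
  then obtain W where W: "\<Delta> ^ r = ?Y * W" by (auto simp: ldvd_def)
  have pW: "pos W" using arg_cong[OF W, of pos] by simp
  have dW: "delta t ldvd W" using YD unfolding W by simp
  have gY: "?g ldvd ?Y" using comm[OF sZ] by simp
  have inf: "is_inf (\<phi> ?Y) 0"
  proof (rule is_inf_0[OF pY])
    have "Suc t \<notin> supp ?Y" using sY T by auto
    moreover have "Suc t \<in> {1..T}" using T by simp
    ultimately show "\<not> {1..T} \<subseteq> supp ?Y" by blast
  qed (simp add: T)
  have "is_inf (inv\<^bsub>G\<^esub> (\<phi> ?Y)) (- int r)"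
  proof (rule is_inf_inv[OF pY])
    have "plen ?Y \<noteq> 0" using r by (cases r) auto
    then show "?Y \<noteq> 1" by (simp only: plen_eq_0 not_False_eq_True)
    show "?Y ldvd \<Delta> ^ r" unfolding W by simp
    show "r \<le> m" if "?Y ldvd \<Delta> ^ m" for m
      using gen_power_ldvd_delta_power ldvd_trans[OF gY that] by blast
  qed
  then have infs: "braid_inf N (\<phi> ?Y) = 0" "braid_inf N (inv\<^bsub>G\<^esub> (\<phi> ?Y)) = - int r"
    using braid_inf_eq inf pY by simp_all
  obtain d1 where d1: "braid_meet N (\<phi> ?Y) (\<phi> \<Delta>) = \<phi> d1" "pos d1" "d1 ldvd ?Y" "d1 ldvd \<Delta>"
    "\<And>u. u ldvd ?Y \<Longrightarrow> u ldvd \<Delta> \<Longrightarrow> u ldvd d1"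
    using ex_braid_meet_phi[OF pY pos_simps(4)] by metis
  obtain d2 where d2: "braid_meet N (\<phi> W) (\<phi> \<Delta>) = \<phi> d2" "pos d2" "d2 ldvd W" "d2 ldvd \<Delta>"
    "\<And>u. u ldvd W \<Longrightarrow> u ldvd \<Delta> \<Longrightarrow> u ldvd d2"
    using ex_braid_meet_phi[OF pW pos_simps(4)] by metis
  have i1: "initial_factor N (\<phi> ?Y) = \<phi> d1"
    unfolding initial_factor_def infs using d1(1) pY by (simp add: garside_Delta_eq)
  \<comment> \<open>The inverse has infimum \<open>- r\<close>, so its initial factor is the meet of
    the complement \<open>W\<close> with the half twist.\<close>
  have "inv\<^bsub>G\<^esub> (\<phi> ?Y) \<otimes>\<^bsub>G\<^esub> garside_Delta N [^]\<^bsub>G\<^esub> (- (- int r)) = \<phi> W"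
  proof -
    have "\<phi> (\<Delta> ^ r) = \<phi> ?Y \<otimes>\<^bsub>G\<^esub> \<phi> W" unfolding W using pY pW by (rule phi_mult)
    then show ?thesis using pY pW inv_solve_left'[of "\<phi> W" "\<phi> ?Y" "\<phi> (\<Delta> ^ r)"] by simp
  qed
  then have i2: "initial_factor N (inv\<^bsub>G\<^esub> (\<phi> ?Y)) = \<phi> d2"
    unfolding initial_factor_def infs using d2(1) by (simp add: garside_Delta_eq)
  have "braid_meet N (\<phi> d1) (\<phi> d2) = \<phi> (delta t)"
  proof (rule braid_meet_phi[OF d1(2) d2(2)])
    show "delta t ldvd d1" by (rule d1(5)) (use dd Z(1) in \<open>simp_all add: ldvd_mult_right\<close>)
    show "delta t ldvd d2" by (rule d2(5)[OF dW dd])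
    fix u assume u: "u ldvd d1" "u ldvd d2"
    obtain e where e: "e ldvd d1" "e ldvd d2" "\<And>u. u ldvd d1 \<Longrightarrow> u ldvd d2 \<Longrightarrow> u ldvd e"
      using ex_gcd by metis
    obtain v where v: "e = delta t * v"
      using e(3) \<open>delta t ldvd d1\<close> \<open>delta t ldvd d2\<close> by (auto simp: ldvd_def)
    have "v = 1"
    proof (cases v rule: pbraid_cases)
      case (2 j v')
      have "j \<in> supp e" using v 2 by simp
      also have "supp e \<subseteq> supp ?Y" using e(1) d1(3) ldvd_trans ldvd_supp by blast
      finally have "j \<in> {1..t} \<union> {T}" using sY by blast
      then consider "1 \<le> j" "j \<le> t" | "j = T" by auto
      then show ?thesis
      proof cases
        case 1
        then obtain w where "delta t = w * gen j" using gen_right_factor_delta by blast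
        then have e': "e = w * (gen j * (gen j * v'))" using v 2 by (simp add: mult.assoc)
        have "e ldvd \<Delta>" using e(1) d1(4) ldvd_trans by blast
        then obtain q where "\<Delta> = e * q" by (auto simp: ldvd_def)
        then have "w * (gen j * (gen j * (v' * q))) = \<Delta>" unfolding e' by (simp only: mult.assoc)
        then show ?thesis using gen_sq_not_factor by blast
      next
        case 2
        have "delta t * gen T ldvd e" using v \<open>v = gen j * v'\<close> 2 by simp
        then have "delta t * gen T ldvd W" using e(2) d2(3) ldvd_trans by blast
        then have "?Y * (delta t * gen T) ldvd \<Delta> ^ r" unfolding W by simp
        moreover have "?Y * (delta t * gen T) = gen T ^ Suc r * (Z * delta t)"
        proof -
          have "?Y * (delta t * gen T) = Z * (?g * (gen T ^ 1 * delta t))"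
            using comm[of "delta t" 1] by (simp add: mult.assoc)
          also have "\<dots> = (Z * gen T ^ Suc r) * delta t"
            by (simp add: mult.assoc power_Suc2 del: power_Suc)
          also have "Z * gen T ^ Suc r = gen T ^ Suc r * Z" by (rule comm[OF sZ])
          finally show ?thesis by (simp add: mult.assoc)
        qed
        ultimately have "gen T ^ Suc r * (Z * delta t) ldvd \<Delta> ^ r" by (simp only:)
        then have "Suc r \<le> r" by (rule gen_power_ldvd_delta_power[OF mult_ldvd_left])
        then show ?thesis by simp
      qed
    qed
    then show "u ldvd delta t" using e(3)[OF u] v by simp
  qed
  then show ?thesis unfolding preferred_prefix_def i1 i2 .
qed

lemma cyclic_sliding_eq:
  assumes T: "T = Suc (Suc t)" and Z: "delta t ldvd Z" "Z * delta t ldvd delta t ^ r" and r: "r > 0"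
    and Z': "delta t * Z' = Z * delta t"
  shows "cyclic_sliding N (\<phi> (Z * gen T ^ r)) = \<phi> (Z' * gen T ^ r)"
proof -
  have "supp (Z * delta t) \<subseteq> {1..t}" using supp_ldvd_delta_power[OF Z(2)] .
  moreover from this have "supp (delta t * Z') \<subseteq> {1..t}" unfolding Z' .
  ultimately have p: "pos Z" "pos Z'" "pos (delta t)" "pos (gen T)" unfolding pos_def using T by auto
  have "Z * gen T ^ r * delta t = Z * (delta t * gen T ^ r)"
    unfolding T using gen_top_commute[of "delta t" t r] by (simp add: mult.assoc)
  also have "\<dots> = delta t * (Z' * gen T ^ r)" using Z' by (simp flip: mult.assoc)
  finally have "\<phi> (Z * gen T ^ r) \<otimes>\<^bsub>G\<^esub> \<phi> (delta t) = \<phi> (delta t) \<otimes>\<^bsub>G\<^esub> \<phi> (Z' * gen T ^ r)"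
    using p by (simp flip: phi_mult)
  then show ?thesis
    unfolding cyclic_sliding_def preferred_prefix_eq[OF T Z r]
    using p inv_solve_left'[of "\<phi> (Z' * gen T ^ r)" "\<phi> (delta t)"] by (simp add: m_assoc)
qed

text \<open>\<open>Z'\<close> inherits both bounds from \<open>Z\<close>, so the second prefix is
  again \<open>delta t\<close>, and two slidings conjugate by \<open>delta t ^ 2\<close>, which
  commutes with \<open>Z\<close> and with \<open>gen T\<close>. The strict bound
  \<open>r > m\<close> supplies the extra half twist for \<open>preferred_prefix_eq\<close>.\<close>

lemma in_sliding_circuit_phi:
  assumes T: "T = Suc (Suc t)" and Z: "delta t ldvd Z" "Z ldvd delta t ^ m" and r: "r > m"
  shows "in_sliding_circuit N (\<phi> (Z * gen T ^ r))"
proof -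
  have r1: "Z * delta t ldvd delta t ^ r" if "Z ldvd delta t ^ m" for Z
  proof -
    have "Z * delta t ldvd delta t ^ (m + 1)" by (rule mult_ldvd_delta_power) (use that in simp_all)
    also have "\<dots> ldvd delta t ^ r"
      using r by (metis Suc_eq_plus1 Suc_leI le_add_diff_inverse ldvd_triv power_add)
    finally (ldvd_trans) show ?thesis .
  qed
  have sZ: "supp Z \<subseteq> {1..t}" using supp_ldvd_delta_power[OF Z(2)] .
  obtain Z' where Z': "Z * delta t = delta t * Z'" using ex_flip[OF sZ] by blast
  have dZ': "delta t ldvd Z'"
  proof -
    obtain V where V: "Z = delta t * V" using Z(1) by (auto simp: ldvd_def)
    have "supp V \<subseteq> {1..t}" using V sZ by simp
    then obtain V' where "V * delta t = delta t * V'" using ex_flip by blast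
    then have "Z' = delta t * V'" using Z' V by (simp add: mult.assoc)
    then show ?thesis by simp
  qed
  have Z'm: "Z' ldvd delta t ^ m"
  proof -
    obtain V where V: "delta t ^ m = Z * V" using Z(2) by (auto simp: ldvd_def)
    have "supp V \<subseteq> supp (delta t ^ m)" using V by auto
    then have "supp V \<subseteq> {1..t}" using supp_power[of "delta t" m] by auto
    then obtain V' where V': "V * delta t = delta t * V'" using ex_flip by blast
    have "delta t * (Z' * V') = Z * V * delta t"
      using V' Z' by (metis mult.assoc)
    also have "\<dots> = delta t * delta t ^ m" by (simp flip: V add: power_commutes)
    finally show ?thesis by (metis ldvd_triv pbraid_left_cancel)
  qed
  have "delta t * (delta t * Z) = delta t ^ (2 * 1) * Z" by (simp add: power2_eq_square mult.assoc)
  also have "\<dots> = Z * delta t ^ (2 * 1)" using delta_sq_central[OF sZ] by metis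
  also have "\<dots> = delta t * (Z' * delta t)" using Z' by (simp add: power2_eq_square flip: mult.assoc)
  finally have Z'': "delta t * Z = Z' * delta t" by simp
  have "(cyclic_sliding N ^^ 2) (\<phi> (Z * gen T ^ r)) = \<phi> (Z * gen T ^ r)"
    using cyclic_sliding_eq[OF T Z(1) r1[OF Z(2)] _ Z'[symmetric]]
      cyclic_sliding_eq[OF T dZ' r1[OF Z'm] _ Z''] r by (simp add: numeral_2_eq_2)
  then show ?thesis unfolding in_sliding_circuit_def by (intro exI[of _ 2]) simp
qed

text \<open>The normal form is explicit: \<open>m\<close> factors \<open>delta t * gen T\<close>,
  one factor \<open>up t * gen T\<close>, then \<open>m'\<close> factors \<open>gen T\<close>. Each
  factor can be made to end in any letter that occurs after it, so \<open>weighted_phi\<close>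
  applies.\<close>

lemma canonical_length_phi:
  assumes T: "T = Suc (Suc t)"
  shows "canonical_length N (\<phi> (delta t ^ m * up t * gen T ^ (m + 1 + m'))) = m + 1 + m'"
proof -
  let ?g = "gen T"
  let ?xs = "replicate m' ?g" and ?d = "delta t * ?g"
  let ?ys = "(up t * ?g) # ?xs"
  have comm: "x * ?g ^ i = ?g ^ i * x" if "supp x \<subseteq> {1..t}" for x i
    unfolding T using gen_top_commute[OF that] .
  have pg: "pos ?g" "pos (up t)" "pos (delta t)" unfolding pos_def using T by auto
  have g1: "x * ?g \<noteq> 1" for x using plen_eq_0[of "x * ?g"] by simp
  have gdvd: "?g ldvd \<Delta>" using T gen_ldvd_delta[of T T] by simp
  have wx: "weighted (map \<phi> ?xs)"
  proof (induction m')
    case (Suc i)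
    have "weighted (map \<phi> (?g # replicate i ?g))"
    proof (rule weighted_phi[OF Suc])
      show "\<exists>w. ?g = w * gen j" if "j \<in> supp (prod_list (replicate i ?g))" for j
        using that unfolding supp_prod_list by (intro exI[of _ 1]) (auto split: if_splits)
    qed (use pg gdvd g1[of 1] in auto)
    then show ?case by simp
  qed simp
  have upd: "up t ldvd delta t"
  proof (cases t)
    case (Suc s)
    then show ?thesis using delta_Suc_up[of s] by (metis ldvd_triv)
  qed simp
  have wy: "weighted (map \<phi> ?ys)"
  proof (rule weighted_phi[OF wx])
    show "up t * ?g ldvd \<Delta>" using mult_gen_ldvd_delta[OF upd] unfolding T .
    show "\<exists>w. up t * ?g = w * gen j" if "j \<in> supp (prod_list ?xs)" for j
      using that unfolding supp_prod_list by (intro exI[of _ "up t"]) (auto split: if_splits)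
  qed (use pg g1 in auto)
  have w: "weighted (map \<phi> (replicate i ?d @ ?ys))" for i
  proof (induction i)
    case (Suc i)
    have "weighted (map \<phi> (?d # (replicate i ?d @ ?ys)))"
    proof (rule weighted_phi[OF Suc])
      show "?d ldvd \<Delta>" using mult_gen_ldvd_delta[OF ldvd_refl] unfolding T .
      fix j assume "j \<in> supp (prod_list (replicate i ?d @ ?ys))"
      then have "j = T \<or> j \<in> {1..t}" unfolding supp_prod_list by (auto split: if_splits)
      then show "\<exists>w. ?d = w * gen j"
      proof
        assume j: "j \<in> {1..t}"
        then obtain w where w: "delta t = w * gen j" using gen_right_factor_delta[of j t] by auto
        have "?d = w * ?g * gen j" using w comm[of "gen j" 1] j by (simp add: mult.assoc)
        then show ?thesis by blast
      qed blast
    qed (use pg g1 in auto)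
    then show ?case by simp
  qed (use wy in simp)
  let ?zs = "replicate m ?d @ ?ys"
  let ?B = "delta t ^ m * up t * gen T ^ (m + 1 + m')"
  have "prod_list ?zs = ?d ^ m * (up t * ?g ^ (1 + m'))"
    by (simp add: mult.assoc)
  also have "?d ^ m = delta t ^ m * ?g ^ m"
    by (rule commute_mult_power) (use comm[of "delta t" 1] in simp)
  also have "delta t ^ m * ?g ^ m * (up t * ?g ^ (1 + m')) = delta t ^ m * (?g ^ m * up t) * ?g ^ (1 + m')"
    by (simp add: mult.assoc)
  also have "?g ^ m * up t = up t * ?g ^ m" using comm[of "up t" m] by simp
  also have "delta t ^ m * (up t * ?g ^ m) * ?g ^ (1 + m')
      = delta t ^ m * up t * (?g ^ m * ?g ^ (1 + m'))"
    by (simp only: mult.assoc)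
  also have "?g ^ m * ?g ^ (1 + m') = ?g ^ (m + 1 + m')"
    by (simp only: add.assoc flip: power_add)
  finally have B: "prod_list ?zs = ?B" .
  have sB: "supp ?B \<subseteq> {1..t} \<union> {T}"
    using supp_power[of "delta t" m] supp_power[of ?g "m + 1 + m'"] by auto
  have pB: "pos ?B" using pg by simp
  have "is_inf (\<phi> ?B) 0"
  proof (rule is_inf_0[OF pB])
    have "Suc t \<notin> supp ?B" using sB T by auto
    moreover have "Suc t \<in> {1..T}" using T by simp
    ultimately show "\<not> {1..T} \<subseteq> supp ?B" by blast
  qed (simp add: T)
  moreover have "braid_prod N (map \<phi> ?zs) = \<phi> ?B"
  proof -
    have "pos z" if "z \<in> set ?zs" for z using that pg by (auto split: if_splits)
    then show ?thesis using braid_prod_phi[of ?zs] unfolding B by blast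
  qed
  ultimately have "left_normal_form N (\<phi> ?B) 0 (map \<phi> ?zs)"
    using w pB unfolding left_normal_form_iff by simp
  then show ?thesis using canonical_length_eq by fastforce
qed

end

section \<open>A family of distinct conjugates\<close>

definition conjugate_witness :: "nat \<Rightarrow> nat \<Rightarrow> bool list \<Rightarrow> nat list \<Rightarrow> pbraid" where
  "conjugate_witness t m bs ls = (SOME Z.
    pword (walk (walk_start bs) ls) * Z
      = delta t ^ Suc m * coxeter bs * pword (walk (walk_start bs) ls) \<and>
    delta t ldvd Z \<and> Z ldvd delta t ^ (2 * Suc m))"

lemma walk_start_range: "length bs + 1 = t \<Longrightarrow> t \<ge> 2 \<Longrightarrow> walk_start bs \<in> {1..t}"
  by (cases bs rule: walk_start.cases) auto

lemma gen_ldvd_walk: "gen j ldvd pword (walk l ls) \<Longrightarrow> j = l"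
proof (cases "walk l ls")
  case (Cons x w)
  assume "gen j ldvd pword (walk l ls)"
  then have "j = x" using rigid_gen_ldvd[of x w j] rigid_walk[of l ls] Cons by simp
  moreover have "ls \<noteq> []" using Cons by auto
  then have "x = l" using walk_hd[of ls l] Cons by simp
  ultimately show ?thesis by simp
qed simp

lemma walk_word_ldvd:
  assumes "length bs + 1 = t" "t \<ge> 2" "set ls \<subseteq> {1..t}" "length ls = m"
  shows "pword (walk (walk_start bs) ls) ldvd delta t ^ m"
  using walk_ldvd_delta_power[OF walk_start_range[OF assms(1,2)] assms(3)] assms(4) by simp

text \<open>The choice in the definition loses nothing: by left cancellation the first property has
  only one solution.\<close>

lemma conjugate_witness:
  assumes "length bs + 1 = t" "t \<ge> 2" "set ls \<subseteq> {1..t}" "length ls = m"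
  shows "pword (walk (walk_start bs) ls) * conjugate_witness t m bs ls
      = delta t ^ Suc m * coxeter bs * pword (walk (walk_start bs) ls)"
    and "delta t ldvd conjugate_witness t m bs ls"
    and "conjugate_witness t m bs ls ldvd delta t ^ (2 * Suc m)"
proof -
  have "coxeter bs ldvd delta t" using coxeter_ldvd_delta[of bs] unfolding assms(1) .
  from someI_ex[OF ex_conjugate[OF walk_word_ldvd[OF assms] this]]
  show "pword (walk (walk_start bs) ls) * conjugate_witness t m bs ls
      = delta t ^ Suc m * coxeter bs * pword (walk (walk_start bs) ls)"
    and "delta t ldvd conjugate_witness t m bs ls"
    and "conjugate_witness t m bs ls ldvd delta t ^ (2 * Suc m)"
    unfolding conjugate_witness_def by blast+
qed

text \<open>The reduced fraction returns \<open>a\<close> and the Coxeter element. The bits are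
  recovered first because they fix the starting letter; rigidity then returns the word of
  \<open>a\<close>, and its doubled letters return the list.\<close>

lemma conjugate_witness_inject:
  assumes t: "t \<ge> 2" and m: "Suc m = 2 * k"
    and bs: "length bs + 1 = t" and ls: "set ls \<subseteq> {1..t}" "length ls = m"
    and bs': "length bs' + 1 = t" and ls': "set ls' \<subseteq> {1..t}" "length ls' = m"
    and eq: "conjugate_witness t m bs ls = conjugate_witness t m bs' ls'"
  shows "bs = bs' \<and> ls = ls'"
proof -
  have ne: "bs \<noteq> []" "bs' \<noteq> []" using t bs bs' by auto
  have C: "pword (walk (walk_start bs) ls) = pword (walk (walk_start bs') ls') \<and>
      coxeter bs = coxeter bs'"
  proof (rule conjugate_inject[of _ t m _ _ _ "conjugate_witness t m bs ls" k])
    show "pword (walk (walk_start bs) ls) ldvd delta t ^ m"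
      "pword (walk (walk_start bs') ls') ldvd delta t ^ m"
      using walk_word_ldvd bs ls bs' ls' t by blast+
    show "supp (coxeter bs) \<subseteq> {1..t}" "supp (coxeter bs') \<subseteq> {1..t}"
      using bs bs' by (auto simp: supp_coxeter)
    show "pword (walk (walk_start bs) ls) * conjugate_witness t m bs ls
      = delta t ^ (2 * k) * coxeter bs * pword (walk (walk_start bs) ls)"
      using conjugate_witness(1)[OF bs t ls] m by simp
    show "pword (walk (walk_start bs') ls') * conjugate_witness t m bs ls
      = delta t ^ (2 * k) * coxeter bs' * pword (walk (walk_start bs') ls')"
      unfolding eq using conjugate_witness(1)[OF bs' t ls'] m by simp
    show "d = 1" if "d ldvd pword (walk (walk_start bs) ls)"
        "d ldvd coxeter bs * pword (walk (walk_start bs) ls)" for d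
      by (rule coxeter_coprime[OF ne(1) _ that]) (erule gen_ldvd_walk)
    show "d = 1" if "d ldvd pword (walk (walk_start bs') ls')"
        "d ldvd coxeter bs' * pword (walk (walk_start bs') ls')" for d
      by (rule coxeter_coprime[OF ne(2) _ that]) (erule gen_ldvd_walk)
  qed
  then have B: "bs = bs'" using coxeter_inject bs bs' by simp
  have "walk (walk_start bs) ls = walk (walk_start bs') ls'"
    using C rigid_pword_inject[OF rigid_walk rigid_walk] by blast
  then show ?thesis using B walk_inject ls ls' by simp
qed

text \<open>The conjugator is \<open>x * a\<close>: \<open>x\<close> relates \<open>up t\<close> to
  \<open>coxeter bs\<close> and commutes with the even power of the half twist, and \<open>a\<close>
  relates the result to the witness.\<close>

lemma conjugate_witness_conjugate:
  assumes t: "t \<ge> 2" and m: "Suc m = 2 * k"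
    and bs: "length bs + 1 = t" and ls: "set ls \<subseteq> {1..t}" "length ls = m"
  shows "\<exists>c. supp c \<subseteq> {1..t} \<and>
    delta t ^ (2 * k) * up t * c = c * conjugate_witness t m bs ls"
proof -
  let ?a = "pword (walk (walk_start bs) ls)" and ?Z = "conjugate_witness t m bs ls"
  obtain x where x: "supp x \<subseteq> {1..t}" "x * coxeter bs = up t * x"
    using coxeter_conjugate_up[of bs] bs by auto
  have "supp ?a \<subseteq> {1..t}"
    using supp_ldvd_delta_power walk_word_ldvd[OF bs t ls] by blast
  moreover have "x * ?a * ?Z = x * (delta t ^ (2 * k) * coxeter bs * ?a)"
    using conjugate_witness(1)[OF bs t ls] unfolding m by (simp add: mult.assoc)
  moreover have "\<dots> = delta t ^ (2 * k) * (x * coxeter bs) * ?a"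
    using delta_sq_central[OF x(1), of k] by (metis mult.assoc)
  ultimately show ?thesis using x by (intro exI[of _ "x * ?a"]) (simp add: mult.assoc)
qed

lemma (in artin_group) conjugate_witness_sliding_circuits:
  assumes T: "T = Suc (Suc t)" and t: "t \<ge> 2" and m: "Suc m = 2 * k"
    and bs: "length bs + 1 = t" and ls: "set ls \<subseteq> {1..t}" "length ls = m"
  shows "\<phi> (conjugate_witness t m bs ls * gen T ^ (4 * k + 1))
    \<in> sliding_circuits N (\<phi> (delta t ^ (2 * k) * up t * gen T ^ (4 * k + 1)))"
proof -
  let ?Z = "conjugate_witness t m bs ls" and ?g = "gen T ^ (4 * k + 1)"
    and ?X = "delta t ^ (2 * k) * up t"
  note Z = conjugate_witness(2,3)[OF bs t ls]
  obtain c where c: "supp c \<subseteq> {1..t}" "?X * c = c * ?Z"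
    using conjugate_witness_conjugate[OF t m bs ls] by blast
  have sZ: "supp ?Z \<subseteq> {1..t}" using supp_ldvd_delta_power[OF Z(2)] .
  have p: "pos c" "pos ?Z" "pos ?X" "pos ?g"
    unfolding pos_def using c(1) sZ T supp_power[of "delta t" "2 * k"] supp_power[of "gen T" "4 * k + 1"]
    by (auto simp del: power_Suc)
  have "?X * ?g * c = ?X * c * ?g"
    using gen_top_commute[OF c(1), of "4 * k + 1"] by (simp only: T mult.assoc)
  also have "\<dots> = c * (?Z * ?g)" unfolding c(2) by (rule mult.assoc)
  finally have "\<phi> (?X * ?g) \<otimes>\<^bsub>G\<^esub> \<phi> c = \<phi> c \<otimes>\<^bsub>G\<^esub> \<phi> (?Z * ?g)"
    using p by (simp only: pos_simps simp_thms flip: phi_mult)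
  then have "\<phi> (?Z * ?g) = inv\<^bsub>G\<^esub> (\<phi> c) \<otimes>\<^bsub>G\<^esub> \<phi> (?X * ?g) \<otimes>\<^bsub>G\<^esub> \<phi> c"
    using p inv_solve_left[of "\<phi> (?Z * ?g)" "\<phi> c" "\<phi> (?X * ?g) \<otimes>\<^bsub>G\<^esub> \<phi> c"]
    by (simp add: m_assoc del: power_Suc)
  \<comment> \<open>The witness divides the power \<open>2 * Suc m = 4 * k\<close>, one less than
    the exponent of \<open>gen T\<close>.\<close>
  moreover have "in_sliding_circuit N (\<phi> (?Z * ?g))"
    by (rule in_sliding_circuit_phi[OF T Z]) (simp add: m)
  ultimately show ?thesis unfolding sliding_circuits_def using p(1) phi_closed by blast
qed

theorem proposition5p5:
  fixes n k :: nat and \<beta> :: braid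
  assumes "n \<ge> 3" and "k \<ge> 1"
    and "\<beta> = braid_prod (n + 2) (map (sigma (n + 2)) [1..<n]) [^]\<^bsub>braid_group (n + 2)\<^esub> (n * k + 1)
              \<otimes>\<^bsub>braid_group (n + 2)\<^esub>
              sigma (n + 2) (n + 1) [^]\<^bsub>braid_group (n + 2)\<^esub> (4 * k + 1)"
  shows "canonical_length (n + 2) \<beta> = 4 * k + 1 \<and>
         {..<2 ^ (n - 2) * (n - 1) ^ (2 * k - 1)} \<lesssim> sliding_circuits (n + 2) \<beta>"
proof -
  obtain t where n: "n = Suc t" and t: "t \<ge> 2" using assms(1) by (cases n) auto
  \<comment> \<open>The number of chains is \<open>m = 2 * k - 1\<close>; evenness of
    \<open>Suc m\<close> makes the power of the half twist central.\<close>
  obtain m where m: "Suc m = 2 * k" using assms(2) by (cases "2 * k") auto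
  define T where "T = n + 1"
  have T: "T = Suc (Suc t)" and N: "n + 2 = Suc T" and T1: "n + 1 = T" by (simp_all add: T_def n)
  interpret artin_group T .
  let ?g = "gen T ^ (4 * k + 1)" and ?X = "delta t ^ (2 * k) * up t"
  have p: "pos (up t)" "pos (gen T)" unfolding pos_def using T by auto
  \<comment> \<open>The exponent amounts to \<open>k\<close> full twists on \<open>n\<close> strands
    and one more \<open>up t\<close>.\<close>
  have "up t ^ (n * k + 1) = (up t ^ n) ^ k * up t"
    by (simp only: power_add power_mult power_one_right)
  also have "up t ^ n = delta t ^ 2" unfolding n by (rule full_twist)
  finally have up: "up t ^ (n * k + 1) = ?X" by (simp only: power_mult)
  have "braid_prod N (map (sigma N) [1..<n]) = \<phi> (up t)"
    unfolding up_def n by (rule braid_prod_sigma) (use T in auto)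
  moreover have "sigma N T = \<phi> (gen T)" using phi_gen[of T] T by simp
  ultimately have "\<beta> = \<phi> (up t) [^]\<^bsub>G\<^esub> (n * k + 1) \<otimes>\<^bsub>G\<^esub> \<phi> (gen T) [^]\<^bsub>G\<^esub> (4 * k + 1)"
    using assms(3)[unfolded N T1] by (simp only:)
  also have "\<dots> = \<phi> (up t ^ (n * k + 1) * ?g)"
    unfolding phi_power[OF p(1), symmetric] phi_power[OF p(2), symmetric]
    by (rule phi_mult[symmetric]) (intro pos_power p)+
  finally have beta: "\<beta> = \<phi> (?X * ?g)" unfolding up .
  \<comment> \<open>There are \<open>2 * k\<close> factors before and \<open>2 * k\<close> factors
    after the one that contains \<open>up t\<close>.\<close>
  have "canonical_length N \<beta> = 4 * k + 1"
    using canonical_length_phi[OF T, of "2 * k" "2 * k"] unfolding beta by (simp del: power_Suc)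
  moreover have "{..<2 ^ (n - 2) * (n - 1) ^ (2 * k - 1)} \<lesssim> sliding_circuits N \<beta>"
  proof -
    \<comment> \<open>The bits choose the Coxeter element and \<open>ls\<close> lists the ends of
      the chains, each among \<open>t = n - 1\<close> letters; the first letter is determined by
      \<open>walk_start\<close>.\<close>
    let ?I = "{bs. set bs \<subseteq> (UNIV :: bool set) \<and> length bs = n - 2} \<times>
      {ls. set ls \<subseteq> {1..t} \<and> length ls = m}"
    let ?F = "\<lambda>(bs, ls). \<phi> (conjugate_witness t m bs ls * ?g)"
    have "card {bs. set bs \<subseteq> (UNIV :: bool set) \<and> length bs = n - 2} = 2 ^ (n - 2)"
      by (subst card_lists_length_eq) simp_all
    moreover have "card {ls. set ls \<subseteq> {1..t} \<and> length ls = m} = (n - 1) ^ (2 * k - 1)"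
      using n by (subst card_lists_length_eq) (simp_all flip: m)
    ultimately have card: "card ?I = 2 ^ (n - 2) * (n - 1) ^ (2 * k - 1)"
      by (simp only: card_cartesian_product)
    have fin: "finite ?I" by (intro finite_cartesian_product finite_lists_length_eq) simp_all
    have "{..<2 ^ (n - 2) * (n - 1) ^ (2 * k - 1)} \<approx> ?I"
      unfolding eqpoll_iff_card[OF finite_lessThan fin] card by (rule card_lessThan)
    then have "{..<2 ^ (n - 2) * (n - 1) ^ (2 * k - 1)} \<lesssim> ?I" by (rule eqpoll_imp_lepoll)
    also have "?I \<lesssim> sliding_circuits N \<beta>"
      unfolding lepoll_def
    proof (intro exI[of _ ?F] conjI)
      have len: "length bs + 1 = t" if "length bs = n - 2" for bs :: "bool list"
        using that n t by simp
      show "?F ` ?I \<subseteq> sliding_circuits N \<beta>"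
      proof (rule image_subsetI)
        fix u assume u: "u \<in> ?I"
        obtain bs ls where "u = (bs, ls)" by (cases u)
        then show "?F u \<in> sliding_circuits N \<beta>"
          using conjugate_witness_sliding_circuits[OF T t m len[of bs], of ls] u
          unfolding beta by simp
      qed
      show "inj_on ?F ?I"
      proof (rule inj_onI)
        fix u v assume uv: "u \<in> ?I" "v \<in> ?I" "?F u = ?F v"
        obtain bs ls bs' ls' where [simp]: "u = (bs, ls)" "v = (bs', ls')" by (cases u, cases v)
        have b: "length bs + 1 = t" "length bs' + 1 = t"
          and l: "set ls \<subseteq> {1..t}" "length ls = m" "set ls' \<subseteq> {1..t}" "length ls' = m"
          using uv(1,2) len by auto
        have "supp (conjugate_witness t m bs ls) \<subseteq> {1..t}"
          "supp (conjugate_witness t m bs' ls') \<subseteq> {1..t}"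
          using conjugate_witness(3)[OF b(1) t l(1,2)] conjugate_witness(3)[OF b(2) t l(3,4)]
            supp_ldvd_delta_power by blast+
        then have "pos (conjugate_witness t m bs ls)" "pos (conjugate_witness t m bs' ls')"
          unfolding pos_def using T by auto
        then have "conjugate_witness t m bs ls * ?g = conjugate_witness t m bs' ls' * ?g"
          using uv(3) p phi_inject[of "conjugate_witness t m bs ls * ?g" "conjugate_witness t m bs' ls' * ?g"]
          by (simp del: power_Suc pbraid_right_cancel)
        then have "conjugate_witness t m bs ls = conjugate_witness t m bs' ls'"
          by (simp only: pbraid_right_cancel)
        then show "u = v" using conjugate_witness_inject[OF t m b(1) l(1,2) b(2) l(3,4)] by simp
      qed
    qed
    finally (lepoll_trans) show ?thesis .
  qed
  ultimately show ?thesis unfolding N by blast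
qed

end
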